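(* Let $c>0$ and $p>1$ be constants and $a_k=\lfloor ck^p\rfloor$, $k\ge1$. Assume $\mathbb E X_i=0$, $X_i\in\mathcal L^\alpha$ for some $\alpha\in(2,4]$, and $\sum_{j=0}^\infty\delta_\alpha(j)<\infty$. Then $$\|V_n-\mathbb EV_n\|_{\alpha/2}=O\big(n^{3/2-3/(2p)+2/\alpha}\big)\qquad(n\to\infty).$$
   Context: Let $(\varepsilon_i)_{i\in\mathbb Z}$ be i.i.d. random variables, $\mathcal F_i$ the $\sigma$-field generated by $(\ldots,\varepsilon_{i-1},\varepsilon_i)$, and $X_i=g(\ldots,\varepsilon_{i-1},\varepsilon_i)$ for a measurable $g$ such that $X_i$ is well defined. $\|\xi\|_p=(\mathbb E|\xi|^p)^{1/p}$ and $\xi\in\mathcal L^p$ means $\|\xi\|_p<\infty$. Physical dependence measure: let $\varepsilon_0'$ have the law of $\varepsilon_0$ and be independent of $(\varepsilon_j)_{j\in\mathbb Z}$; for $i\ge0$ set $X_i'=g(\ldots,\varepsilon_{-1},\varepsilon_0',\varepsilon_1,\ldots,\varepsilon_i)$ and $\delta_p(i)=\|X_i-X_i'\|_p$. Given an integer sequence $(a_k)_{k\ge1}$ with $a_k\to\infty$, define for $i\ge1$: $t_i=\max(\{1\}\cup\{a_k:k\ge1,\ a_k\le i\})$, $W_i=X_{t_i}+\cdots+X_i$, $l_i=i-t_i+1$, $V_n=\sum_{i=1}^nW_i^2$, $v_n=\sum_{i=1}^nl_i$. *)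

theory Defs
  imports "HOL-Probability.Probability" "HOL-Library.Landau_Symbols"
begin

definition lpnorm :: "'a measure \<Rightarrow> real \<Rightarrow> ('a \<Rightarrow> real) \<Rightarrow> real" where
  "lpnorm M p f = (\<integral>\<omega>. \<bar>f \<omega>\<bar> powr p \<partial>M) powr (1 / p)"

text \<open>Bernoulli shift X_i = g(..., eps_{i-1}, eps_i): the argument of g is the
  sequence k maps to eps_{i-k}, k = 0,1,2,...\<close>
definition Xshift :: "(int \<Rightarrow> 'a \<Rightarrow> 'e) \<Rightarrow> ((nat \<Rightarrow> 'e) \<Rightarrow> real) \<Rightarrow> int \<Rightarrow> 'a \<Rightarrow> real" where
  "Xshift \<epsilon> g i \<omega> = g (\<lambda>k. \<epsilon> (i - int k) \<omega>)"

text \<open>Coupled version X_i' (for i >= 0): eps_0 replaced by eps_0'.\<close>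
definition Xcoupled :: "(int \<Rightarrow> 'a \<Rightarrow> 'e) \<Rightarrow> ('a \<Rightarrow> 'e) \<Rightarrow> ((nat \<Rightarrow> 'e) \<Rightarrow> real) \<Rightarrow> int \<Rightarrow> 'a \<Rightarrow> real" where
  "Xcoupled \<epsilon> \<epsilon>' g i \<omega> = g (\<lambda>k. if int k = i then \<epsilon>' \<omega> else \<epsilon> (i - int k) \<omega>)"

definition phys_dep :: "'a measure \<Rightarrow> (int \<Rightarrow> 'a \<Rightarrow> 'e) \<Rightarrow> ('a \<Rightarrow> 'e) \<Rightarrow> ((nat \<Rightarrow> 'e) \<Rightarrow> real)
    \<Rightarrow> real \<Rightarrow> nat \<Rightarrow> real" where
  "phys_dep M \<epsilon> \<epsilon>' g p j = lpnorm M p (\<lambda>\<omega>. Xshift \<epsilon> g (int j) \<omega> - Xcoupled \<epsilon> \<epsilon>' g (int j) \<omega>)"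

definition tblock :: "(nat \<Rightarrow> nat) \<Rightarrow> nat \<Rightarrow> nat" where
  "tblock a i = Max ({1} \<union> {a k | k. k \<ge> 1 \<and> a k \<le> i})"

definition Wblock :: "(nat \<Rightarrow> nat) \<Rightarrow> (int \<Rightarrow> 'a \<Rightarrow> real) \<Rightarrow> nat \<Rightarrow> 'a \<Rightarrow> real" where
  "Wblock a X i \<omega> = (\<Sum>j = tblock a i..i. X (int j) \<omega>)"

definition Vsum :: "(nat \<Rightarrow> nat) \<Rightarrow> (int \<Rightarrow> 'a \<Rightarrow> real) \<Rightarrow> nat \<Rightarrow> 'a \<Rightarrow> real" where
  "Vsum a X n \<omega> = (\<Sum>i = 1..n. (Wblock a X i \<omega>)\<^sup>2)"

end

theory Submission
  imports Defs
begin

text \<open>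
  Order the innovations by recency, so that every variable involved becomes a function \<open>Y\<close> of an
  i.i.d. sequence \<open>x\<^sub>0, x\<^sub>1, \<dots>\<close>. Averaging \<open>Y\<close> over the coordinates \<open>\<ge> k\<close> yields a martingale whose
  \<open>k\<close>-th increment is bounded in norm by the effect on \<open>Y\<close> of resampling \<open>x\<^sub>k\<close>. Martingale moment
  inequalities then give two Efron-Stein bounds: \<open>\<parallel>Y - EY\<parallel>\<^sub>q\<^sup>q = O(\<Sum>\<^sub>k I\<^sub>k\<^sup>q)\<close> for \<open>1 < q \<le> 2\<close> and
  \<open>\<parallel>Y - EY\<parallel>\<^sub>\<alpha>\<^sup>2 = O(\<Sum>\<^sub>k I\<^sub>k\<^sup>2)\<close> for \<open>\<alpha> > 2\<close>, where \<open>I\<^sub>k\<close> is that resampling effect in the relevant norm.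

  If all blocks have length at most \<open>L\<close>, the second bound gives \<open>\<parallel>W\<^sub>i\<parallel>\<^sub>\<alpha> = O(L\<^sup>1\<^sup>/\<^sup>2)\<close>. By Cauchy-Schwarz the
  effect of \<open>x\<^sub>k\<close> on \<open>V\<^sub>n\<close> in the \<open>\<alpha>/2\<close>-norm is \<open>O(L\<^sup>3\<^sup>/\<^sup>2 b\<^sub>k)\<close>, where \<open>b\<^sub>k\<close> is the sum of the dependence
  coefficients linking \<open>x\<^sub>k\<close> to \<open>X\<^sub>1, \<dots>, X\<^sub>n\<close>, so \<open>b\<^sub>k = O(1)\<close> and \<open>\<Sum>\<^sub>k b\<^sub>k = O(n)\<close>. The first bound with
  \<open>q = \<alpha>/2\<close> gives \<open>O(L\<^sup>3\<^sup>/\<^sup>2 n\<^sup>2\<^sup>/\<^sup>\<alpha>)\<close>, and \<open>L = O(n\<^sup>1\<^sup>-\<^sup>1\<^sup>/\<^sup>p)\<close>.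
\<close>

section \<open>Signed powers and pointwise inequalities for powers of absolute values\<close>

definition sgn_powr :: "real \<Rightarrow> real \<Rightarrow> real" where
  "sgn_powr r x = sgn x * \<bar>x\<bar> powr r"

lemma abs_sgn_powr [simp]: "\<bar>sgn_powr r x\<bar> = \<bar>x\<bar> powr r"
  by (auto simp: sgn_powr_def abs_mult abs_sgn_eq)

lemma sgn_powr_minus: "sgn_powr r (- x) = - sgn_powr r x"
  by (simp add: sgn_powr_def)

lemma sgn_powr_0: "sgn_powr r 0 = 0"
  by (simp add: sgn_powr_def)

lemma sgn_powr_measurable [measurable]: "sgn_powr r \<in> borel_measurable borel"
  unfolding sgn_powr_def by measurable

text \<open>Signed powers are introduced for the sake of this derivative. Away from 0 the power rule
  applies to \<open>x\<close> or to \<open>- x\<close>; at 0 the difference quotient has absolute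
  value |h|^(q-1), which tends to 0 because q > 1.\<close>

lemma has_real_derivative_abs_powr:
  fixes x q :: real
  assumes "1 < q"
  shows "((\<lambda>x. \<bar>x\<bar> powr q) has_real_derivative q * sgn_powr (q - 1) x) (at x)"
proof -
  consider "x > 0" | "x < 0" | "x = 0" by linarith
  then show ?thesis
  proof cases
    case 1
    have "((\<lambda>x. x powr q) has_real_derivative q * sgn_powr (q - 1) x) (at x)"
      using 1 by (auto intro!: derivative_eq_intros simp: sgn_powr_def)
    moreover have "eventually (\<lambda>y. y \<in> {0<..}) (nhds x)"
      using 1 by (intro eventually_nhds_in_open) auto
    then have ev: "eventually (\<lambda>y. \<bar>y\<bar> powr q = y powr q) (nhds x)"
      by eventually_elim auto
    ultimately show ?thesis
      using DERIV_cong_ev[OF refl ev refl] by simp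
  next
    case 2
    have "((\<lambda>x. (- x) powr q) has_real_derivative q * sgn_powr (q - 1) x) (at x)"
      using 2 by (auto intro!: derivative_eq_intros simp: sgn_powr_def)
    moreover have "eventually (\<lambda>y. y \<in> {..<0}) (nhds x)"
      using 2 by (intro eventually_nhds_in_open) auto
    then have ev: "eventually (\<lambda>y. \<bar>y\<bar> powr q = (- y) powr q) (nhds x)"
      by eventually_elim auto
    ultimately show ?thesis
      using DERIV_cong_ev[OF refl ev refl] by simp
  next
    case 3
    have "((\<lambda>h::real. \<bar>h\<bar> powr (q - 1)) \<longlongrightarrow> 0) (at 0)"
      using assms by (auto intro!: tendsto_eq_intros)
    then have "((\<lambda>h. \<bar>\<bar>h\<bar> powr q / h\<bar>) \<longlongrightarrow> 0) (at 0)"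
    proof (rule Lim_transform_eventually)
      show "\<forall>\<^sub>F h in at 0. \<bar>h\<bar> powr (q - 1) = \<bar>\<bar>h\<bar> powr q / h\<bar>"
        by (auto simp: eventually_at powr_diff intro!: exI[of _ 1])
    qed
    then have "((\<lambda>h. \<bar>h\<bar> powr q / h) \<longlongrightarrow> 0) (at 0)"
      by (rule tendsto_rabs_zero_cancel)
    then show ?thesis using 3 assms by (simp add: DERIV_def sgn_powr_def)
  qed
qed

text \<open>Division by a + b gives two ratios in [0,1] with sum 1, and there u \<le> u^r because r
  \<le> 1.\<close>

lemma add_powr_le_powr_add:
  fixes a b r :: real
  assumes "0 \<le> a" "0 \<le> b" "0 < r" "r \<le> 1"
  shows "(a + b) powr r \<le> a powr r + b powr r"
proof (cases "a + b = 0")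
  case False
  then have s: "0 < a + b" using assms by linarith
  have "u / (a + b) \<le> (u / (a + b)) powr r" if "0 \<le> u" "u \<le> a + b" for u
    using powr_mono'[of r 1 "u / (a + b)"] that assms s by simp
  from this[of a] this[of b] have "1 \<le> (a / (a + b)) powr r + (b / (a + b)) powr r"
    using assms s add_divide_distrib[of a b "a + b"] by simp
  then show ?thesis
    using assms s by (simp add: powr_divide add_divide_distrib[symmetric])
qed (use assms in auto)

lemma powr_add_le_double:
  fixes a b r :: real
  assumes "0 \<le> a" "0 \<le> b" "0 \<le> r"
  shows "(a + b) powr r \<le> 2 powr r * (a powr r + b powr r)"
proof -
  have "(a + b) powr r \<le> (2 * max a b) powr r"
    using assms by (intro powr_mono2) auto
  also have "\<dots> = 2 powr r * max a b powr r"
    using assms by (simp add: powr_mult)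
  also have "\<dots> \<le> 2 powr r * (a powr r + b powr r)"
    by (intro mult_left_mono) (auto simp: max_def)
  finally show ?thesis .
qed

text \<open>For equal signs, subadditivity of the power gives the constant 1. For opposite signs
  both |u| and |v| are at most |u - v|, which costs the factor 2.\<close>

lemma sgn_powr_holder:
  fixes u v r :: real
  assumes "0 < r" "r \<le> 1"
  shows "\<bar>sgn_powr r u - sgn_powr r v\<bar> \<le> 2 * \<bar>u - v\<bar> powr r"
proof -
  have same: "\<bar>sgn_powr r u - sgn_powr r v\<bar> \<le> \<bar>u - v\<bar> powr r" if "0 \<le> v" "v \<le> u" for u v
  proof -
    have "u powr r \<le> v powr r + (u - v) powr r" "v powr r \<le> u powr r"
      using add_powr_le_powr_add[of v "u - v" r] that assms by (auto intro: powr_mono2)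
    moreover have "sgn_powr r w = w powr r" if "0 \<le> w" for w
      using that by (cases "w = 0") (auto simp: sgn_powr_def)
    ultimately show ?thesis using that by simp
  qed
  have pos: "\<bar>sgn_powr r u - sgn_powr r v\<bar> \<le> \<bar>u - v\<bar> powr r" if "0 \<le> v" "0 \<le> u" for u v
    using same[of u v] same[of v u] that by (cases "u \<le> v") (auto simp: abs_minus_commute)
  have opp: "\<bar>sgn_powr r u - sgn_powr r v\<bar> \<le> 2 * \<bar>u - v\<bar> powr r" if "u \<le> 0" "0 \<le> v" for u v
  proof -
    have "\<bar>sgn_powr r u - sgn_powr r v\<bar> \<le> \<bar>u\<bar> powr r + \<bar>v\<bar> powr r"
      by (metis abs_sgn_powr abs_triangle_ineq4)
    moreover have "\<bar>u\<bar> powr r \<le> \<bar>u - v\<bar> powr r" "\<bar>v\<bar> powr r \<le> \<bar>u - v\<bar> powr r"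
      using that assms by (auto intro!: powr_mono2)
    ultimately show ?thesis by linarith
  qed
  consider "0 \<le> u" "0 \<le> v" | "u \<le> 0" "v \<le> 0" | "u \<le> 0" "0 \<le> v" | "0 \<le> u" "v \<le> 0" by linarith
  then show ?thesis
  proof cases
    case 1
    show ?thesis
      using pos[of v u] 1 powr_ge_zero[of "\<bar>u - v\<bar>" r] by linarith
  next
    case 2
    then have "\<bar>sgn_powr r u - sgn_powr r v\<bar> \<le> \<bar>u - v\<bar> powr r"
      using pos[of "-v" "-u"] by (simp add: sgn_powr_minus abs_minus_commute add.commute)
    then show ?thesis using powr_ge_zero[of "\<bar>u - v\<bar>" r] by linarith
  next
    case 3
    then show ?thesis by (rule opp)
  next
    case 4
    then show ?thesis using opp[of v u] by (simp add: abs_minus_commute)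
  qed
qed

text \<open>The mean value theorem is applied in the parameter s along the segment from x to x + y,
  so no case split on the sign of y arises.\<close>

lemma abs_powr_mean_value:
  fixes x y q :: real
  assumes "1 < q"
  obtains s where "0 < s" "s < 1"
    "\<bar>x + y\<bar> powr q - \<bar>x\<bar> powr q = q * sgn_powr (q - 1) (x + s * y) * y"
proof -
  have "((\<lambda>s. \<bar>x + s * y\<bar> powr q) has_real_derivative q * sgn_powr (q - 1) (x + s * y) * y) (at s)" for s
    by (rule DERIV_chain2[OF has_real_derivative_abs_powr[OF assms]])
      (auto intro!: derivative_eq_intros)
  then obtain s where "0 < s" "s < 1" "\<bar>x + 1 * y\<bar> powr q - \<bar>x + 0 * y\<bar> powr q
      = (1 - 0) * (q * sgn_powr (q - 1) (x + s * y) * y)"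
    using MVT2[of 0 1 "\<lambda>s. \<bar>x + s * y\<bar> powr q" "\<lambda>s. q * sgn_powr (q - 1) (x + s * y) * y"] by auto
  then show ?thesis using that[of s] by simp
qed

text \<open>Pointwise source of \<open>von_Bahr_Esseen\<close>, where the linear term integrates to
  0. The mean value formula has the derivative at an intermediate point; moving it to x costs an
  error of order |y|^(q-1) by \<open>sgn_powr_holder\<close>.\<close>

lemma abs_add_powr_le:
  fixes x y q :: real
  assumes "1 < q" "q \<le> 2"
  shows "\<bar>x + y\<bar> powr q \<le> \<bar>x\<bar> powr q + q * sgn_powr (q - 1) x * y + 2 * q * \<bar>y\<bar> powr q"
proof -
  obtain s where s: "0 < s" "s < 1"
    "\<bar>x + y\<bar> powr q - \<bar>x\<bar> powr q = q * sgn_powr (q - 1) (x + s * y) * y"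
    using abs_powr_mean_value assms(1) by blast
  let ?d = "sgn_powr (q - 1) (x + s * y) - sgn_powr (q - 1) x"
  have "\<bar>?d\<bar> \<le> 2 * \<bar>s * y\<bar> powr (q - 1)"
    using sgn_powr_holder[of "q - 1" "x + s * y" x] assms by simp
  also have "\<dots> \<le> 2 * \<bar>y\<bar> powr (q - 1)"
    using s assms by (intro mult_left_mono powr_mono2) (auto simp: abs_mult mult_left_le_one_le)
  finally have "\<bar>?d * y\<bar> \<le> 2 * \<bar>y\<bar> powr (q - 1) * \<bar>y\<bar>"
    by (simp add: abs_mult mult_right_mono)
  also have "\<dots> = 2 * \<bar>y\<bar> powr q"
    by (cases "y = 0") (auto simp: powr_diff)
  finally have "?d * y \<le> 2 * \<bar>y\<bar> powr q" by linarith
  then have "q * (?d * y) \<le> q * (2 * \<bar>y\<bar> powr q)"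
    using assms by (intro mult_left_mono) auto
  then show ?thesis using s by (simp add: algebra_simps)
qed

text \<open>Takes the place of \<open>sgn_powr_holder\<close> for exponents above 1, where the
  signed power is Lipschitz only on bounded ranges. Equal signs use the mean value theorem; for
  opposite signs the comparison passes through 0.\<close>

lemma sgn_powr_lipschitz:
  fixes u v r B :: real
  assumes "1 < r" "\<bar>u\<bar> \<le> B" "\<bar>v\<bar> \<le> B"
  shows "\<bar>sgn_powr r u - sgn_powr r v\<bar> \<le> 2 * r * B powr (r - 1) * \<bar>u - v\<bar>"
proof -
  have eq: "sgn_powr r w = \<bar>w\<bar> powr (r - 1) * w" for w
    by (cases "w = 0") (auto simp: sgn_powr_def powr_diff sgn_if)
  have same: "\<bar>sgn_powr r u - sgn_powr r v\<bar> \<le> r * B powr (r - 1) * \<bar>u - v\<bar>"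
    if "0 \<le> v" "v \<le> u" "u \<le> B" for u v
  proof (cases "u = v")
    case False
    then have "v < u" using that by simp
    then obtain z where z: "v < z" "z < u" "\<bar>u\<bar> powr r - \<bar>v\<bar> powr r = (u - v) * (r * sgn_powr (r - 1) z)"
      using MVT2[of v u "\<lambda>x. \<bar>x\<bar> powr r" "\<lambda>x. r * sgn_powr (r - 1) x"]
        has_real_derivative_abs_powr[OF assms(1)] by blast
    have "sgn_powr r w = \<bar>w\<bar> powr r" if "0 \<le> w" for w
      using that by (cases "w = 0") (auto simp: sgn_powr_def)
    then have "\<bar>sgn_powr r u - sgn_powr r v\<bar> = \<bar>u - v\<bar> * (r * \<bar>z\<bar> powr (r - 1))"
      using z that assms(1) by (simp add: abs_mult)
    also have "\<dots> \<le> \<bar>u - v\<bar> * (r * B powr (r - 1))"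
      using z that assms(1) by (intro mult_left_mono powr_mono2) auto
    finally show ?thesis by (simp add: mult_ac)
  qed simp
  have pos: "\<bar>sgn_powr r u - sgn_powr r v\<bar> \<le> r * B powr (r - 1) * \<bar>u - v\<bar>"
    if "0 \<le> v" "0 \<le> u" "v \<le> B" "u \<le> B" for u v
    using same[of u v] same[of v u] that by (cases "u \<le> v") (auto simp: abs_minus_commute)
  have opp: "\<bar>sgn_powr r u - sgn_powr r v\<bar> \<le> 2 * r * B powr (r - 1) * \<bar>u - v\<bar>"
    if "u \<le> 0" "0 \<le> v" "-u \<le> B" "v \<le> B" for u v
  proof -
    have "\<bar>sgn_powr r u - sgn_powr r v\<bar> \<le> \<bar>u\<bar> powr r + \<bar>v\<bar> powr r"
      by (metis abs_sgn_powr abs_triangle_ineq4)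
    also have "\<dots> \<le> r * B powr (r - 1) * \<bar>u\<bar> + r * B powr (r - 1) * \<bar>v\<bar>"
      using pos[of 0 "-u"] pos[of 0 v] that by (simp add: sgn_powr_minus sgn_powr_0)
    also have "\<dots> = r * B powr (r - 1) * \<bar>u - v\<bar>"
      using that by (simp add: algebra_simps)
    also have "\<dots> \<le> 2 * (r * B powr (r - 1) * \<bar>u - v\<bar>)"
      using assms(1) by simp
    finally show ?thesis by simp
  qed
  have half: "r * B powr (r - 1) * \<bar>u - v\<bar> \<le> 2 * r * B powr (r - 1) * \<bar>u - v\<bar>" for u v
    using assms(1) by (intro mult_right_mono) auto
  consider "0 \<le> u" "0 \<le> v" | "u \<le> 0" "v \<le> 0" | "u \<le> 0" "0 \<le> v" | "0 \<le> u" "v \<le> 0" by linarith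
  then show ?thesis
  proof cases
    case 1
    show ?thesis
      using pos[of v u] 1 assms half[of u v] by linarith
  next
    case 2
    then have "\<bar>sgn_powr r u - sgn_powr r v\<bar> \<le> r * B powr (r - 1) * \<bar>u - v\<bar>"
      using pos[of "-v" "-u"] assms by (simp add: sgn_powr_minus abs_minus_commute add.commute)
    then show ?thesis using half[of u v] by linarith
  next
    case 3
    then show ?thesis using assms by (intro opp) auto
  next
    case 4
    then show ?thesis using opp[of v u] assms by (simp add: abs_minus_commute)
  qed
qed

text \<open>Counterpart of \<open>abs_add_powr_le\<close> above exponent 2 and source of
  \<open>Rio_inequality\<close>. Between the two points the derivative has a Lipschitz constant of
  order (|x| + |y|)^(a-2); splitting this power separates the term quadratic in y from
  |y|^a.\<close>

lemma abs_add_powr_le_ge2: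
  fixes x y a :: real
  assumes "2 < a"
  shows "\<bar>x + y\<bar> powr a \<le> \<bar>x\<bar> powr a + a * sgn_powr (a - 1) x * y
      + 2 * a * a * 2 powr a * (\<bar>x\<bar> powr (a - 2) * y\<^sup>2 + \<bar>y\<bar> powr a)"
proof -
  obtain s where s: "0 < s" "s < 1"
    "\<bar>x + y\<bar> powr a - \<bar>x\<bar> powr a = a * sgn_powr (a - 1) (x + s * y) * y"
    using abs_powr_mean_value[of a x y] assms by auto
  let ?d = "sgn_powr (a - 1) (x + s * y) - sgn_powr (a - 1) x"
  let ?B = "\<bar>x\<bar> + \<bar>y\<bar>"
  have sy: "\<bar>s * y\<bar> \<le> \<bar>y\<bar>" using s by (simp add: abs_mult mult_left_le_one_le)
  have "\<bar>?d\<bar> \<le> 2 * (a - 1) * ?B powr (a - 2) * \<bar>s * y\<bar>"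
    using sgn_powr_lipschitz[of "a - 1" "x + s * y" ?B x] assms sy by (simp add: abs_triangle_ineq)
  also have "\<dots> \<le> 2 * a * ?B powr (a - 2) * \<bar>y\<bar>"
    using sy assms by (intro mult_mono) auto
  also have "\<dots> \<le> 2 * a * (2 powr (a - 2) * (\<bar>x\<bar> powr (a - 2) + \<bar>y\<bar> powr (a - 2))) * \<bar>y\<bar>"
    using assms by (intro mult_right_mono mult_left_mono powr_add_le_double) auto
  also have "\<dots> \<le> 2 * a * (2 powr a * (\<bar>x\<bar> powr (a - 2) + \<bar>y\<bar> powr (a - 2))) * \<bar>y\<bar>"
    using assms by (intro mult_right_mono mult_left_mono) auto
  finally have "\<bar>?d * y\<bar> \<le> 2 * a * (2 powr a * (\<bar>x\<bar> powr (a - 2) + \<bar>y\<bar> powr (a - 2))) * \<bar>y\<bar> * \<bar>y\<bar>"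
    by (simp add: abs_mult mult_right_mono)
  also have "\<dots> = 2 * a * 2 powr a * (\<bar>x\<bar> powr (a - 2) * y\<^sup>2 + \<bar>y\<bar> powr (a - 2) * y\<^sup>2)"
    by (simp add: algebra_simps power2_eq_square)
  also have "\<bar>y\<bar> powr (a - 2) * y\<^sup>2 = \<bar>y\<bar> powr a"
    by (cases "y = 0") (auto simp: powr_diff powr_numeral)
  finally have "?d * y \<le> 2 * a * 2 powr a * (\<bar>x\<bar> powr (a - 2) * y\<^sup>2 + \<bar>y\<bar> powr a)" by linarith
  then have "a * (?d * y) \<le> a * (2 * a * 2 powr a * (\<bar>x\<bar> powr (a - 2) * y\<^sup>2 + \<bar>y\<bar> powr a))"
    using assms by (intro mult_left_mono) auto
  then show ?thesis using s by (simp add: algebra_simps)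
qed

lemma sgn_powr_mono:
  fixes u v r :: real
  assumes "0 < r" "u \<le> v"
  shows "sgn_powr r u \<le> sgn_powr r v"
proof -
  consider "0 \<le> u" | "v \<le> 0" | "u < 0" "0 < v" by linarith
  then show ?thesis
  proof cases
    case 1
    then have "u powr r \<le> v powr r" using assms by (intro powr_mono2) auto
    then show ?thesis using 1 assms by (cases "u = 0") (auto simp: sgn_powr_def)
  next
    case 2
    then have "(-v) powr r \<le> (-u) powr r" using assms by (intro powr_mono2) auto
    then show ?thesis using 2 assms by (cases "v = 0") (auto simp: sgn_powr_def mult_nonpos_nonneg)
  next
    case 3
    have "sgn_powr r u \<le> 0" "0 \<le> sgn_powr r v" using 3 by (auto simp: sgn_powr_def)
    then show ?thesis by linarith
  qed
qed

lemma convex_on_abs_powr: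
  assumes "1 < p"
  shows "convex_on UNIV (\<lambda>x::real. \<bar>x\<bar> powr p)"
proof (rule convex_on_realI[where f' = "\<lambda>x. p * sgn_powr (p - 1) x"])
  show "p * sgn_powr (p - 1) x \<le> p * sgn_powr (p - 1) y" if "x \<le> y" for x y
    using sgn_powr_mono[of "p - 1" x y] that assms by (intro mult_left_mono) auto
qed (use assms in \<open>auto intro: has_real_derivative_abs_powr\<close>)

lemma powr_mult_powr_le:
  fixes x y r s :: real
  assumes "0 \<le> x" "0 \<le> y" "0 \<le> r" "0 \<le> s"
  shows "x powr r * y powr s \<le> x powr (r + s) + y powr (r + s)"
proof -
  have "x powr r * y powr s \<le> max x y powr r * max x y powr s"
    using assms by (intro mult_mono powr_mono2) auto
  also have "\<dots> = max x y powr (r + s)" by (simp add: powr_add)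
  also have "\<dots> \<le> x powr (r + s) + y powr (r + s)" by (simp add: max_def)
  finally show ?thesis .
qed

section \<open>Lebesgue spaces\<close>

text \<open>Membership has to be tracked apart from \<open>lpnorm\<close>: the Bochner integral of a
  non-integrable function is 0, so a small \<open>lpnorm\<close> alone proves nothing.\<close>

definition Lp :: "'a measure \<Rightarrow> real \<Rightarrow> ('a \<Rightarrow> real) set" where
  "Lp M p = {f \<in> borel_measurable M. integrable M (\<lambda>x. \<bar>f x\<bar> powr p)}"

lemma Lp_measurable: "f \<in> Lp M p \<Longrightarrow> f \<in> borel_measurable M"
  and Lp_integrable_powr: "f \<in> Lp M p \<Longrightarrow> integrable M (\<lambda>x. \<bar>f x\<bar> powr p)"
  by (auto simp: Lp_def)

lemma lpnorm_nonneg [simp]: "0 \<le> lpnorm M p f"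
  by (simp add: lpnorm_def)

lemma lpnorm_powr: "0 < p \<Longrightarrow> lpnorm M p f powr p = (\<integral>x. \<bar>f x\<bar> powr p \<partial>M)"
  by (simp add: lpnorm_def powr_powr)

lemma lpnorm_le:
  assumes "0 < p" "0 \<le> B" "(\<integral>x. \<bar>f x\<bar> powr p \<partial>M) \<le> B powr p"
  shows "lpnorm M p f \<le> B"
proof -
  have "lpnorm M p f \<le> (B powr p) powr (1 / p)"
    unfolding lpnorm_def using assms by (intro powr_mono2) auto
  then show ?thesis using assms by (simp add: powr_powr)
qed

lemma Lp_add:
  assumes "f \<in> Lp M p" "g \<in> Lp M p" "0 \<le> p"
  shows "(\<lambda>x. f x + g x) \<in> Lp M p"
proof -
  have [measurable]: "f \<in> borel_measurable M" "g \<in> borel_measurable M"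
    using assms by (auto simp: Lp_def)
  have *: "\<bar>f x + g x\<bar> powr p \<le> 2 powr p * (\<bar>f x\<bar> powr p + \<bar>g x\<bar> powr p)" for x
  proof -
    have "\<bar>f x + g x\<bar> powr p \<le> (\<bar>f x\<bar> + \<bar>g x\<bar>) powr p"
      using assms by (intro powr_mono2) auto
    also have "\<dots> \<le> 2 powr p * (\<bar>f x\<bar> powr p + \<bar>g x\<bar> powr p)"
      using assms by (intro powr_add_le_double) auto
    finally show ?thesis .
  qed
  have "integrable M (\<lambda>x. \<bar>f x + g x\<bar> powr p)"
  proof (rule Bochner_Integration.integrable_bound)
    show "integrable M (\<lambda>x. 2 powr p * (\<bar>f x\<bar> powr p + \<bar>g x\<bar> powr p))"
      using assms by (simp add: Lp_def)
    show "AE x in M. norm (\<bar>f x + g x\<bar> powr p) \<le> norm (2 powr p * (\<bar>f x\<bar> powr p + \<bar>g x\<bar> powr p))"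
      using * by (intro AE_I2) simp
  qed measurable
  then show ?thesis by (simp add: Lp_def)
qed

lemma Lp_cmult:
  assumes "f \<in> Lp M p"
  shows "(\<lambda>x. c * f x) \<in> Lp M p"
  using assms by (auto simp: Lp_def abs_mult powr_mult)

lemma Lp_diff:
  assumes "f \<in> Lp M p" "g \<in> Lp M p" "0 \<le> p"
  shows "(\<lambda>x. f x - g x) \<in> Lp M p"
  using Lp_add[OF assms(1) Lp_cmult[OF assms(2), of "-1"] assms(3)] by simp

lemma Lp_sum:
  assumes "\<And>i. i \<in> I \<Longrightarrow> f i \<in> Lp M p" "0 < p"
  shows "(\<lambda>x. \<Sum>i\<in>I. f i x) \<in> Lp M p"
  using assms(1)
proof (induction I rule: infinite_finite_induct)
  case (insert i I)
  then show ?case using Lp_add[of "f i" M p "\<lambda>x. \<Sum>i\<in>I. f i x"] assms(2) by simp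
qed (use assms(2) in \<open>auto simp: Lp_def\<close>)

lemma (in finite_measure) Lp_const: "(\<lambda>x. c) \<in> Lp M p"
  by (simp add: Lp_def)

lemma (in finite_measure) Lp_integrable:
  assumes "f \<in> Lp M p" "1 \<le> p"
  shows "integrable M f"
proof (rule Bochner_Integration.integrable_bound)
  show "integrable M (\<lambda>x. 1 + \<bar>f x\<bar> powr p)" using assms by (auto simp: Lp_def)
  have "\<bar>f x\<bar> \<le> 1 + \<bar>f x\<bar> powr p" for x
  proof (cases "\<bar>f x\<bar> \<le> 1")
    case False
    then have "\<bar>f x\<bar> powr 1 \<le> \<bar>f x\<bar> powr p" using assms by (intro powr_mono) auto
    then show ?thesis using False by simp
  qed (simp add: add_increasing2)
  then show "AE x in M. norm (f x) \<le> norm (1 + \<bar>f x\<bar> powr p)"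
    by (auto simp: abs_of_nonneg add_nonneg_nonneg)
qed (use assms in \<open>auto simp: Lp_def\<close>)

lemma (in prob_space) abs_expectation_powr_le:
  assumes "f \<in> Lp M p" "1 < p"
  shows "\<bar>expectation f\<bar> powr p \<le> expectation (\<lambda>x. \<bar>f x\<bar> powr p)"
proof (rule jensens_inequality[of f UNIV])
  show "integrable M f" using Lp_integrable[of f p] assms by simp
  show "integrable M (\<lambda>x. \<bar>f x\<bar> powr p)" using assms by (simp add: Lp_def)
  show "convex_on UNIV (\<lambda>x::real. \<bar>x\<bar> powr p)" using assms by (intro convex_on_abs_powr)
qed simp_all

lemma Lp_eq_0_AE:
  assumes "f \<in> Lp M p" "0 < p" "lpnorm M p f = 0"
  shows "AE x in M. f x = 0"
proof -
  have "(\<integral>x. \<bar>f x\<bar> powr p \<partial>M) = 0"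
    using assms lpnorm_powr[of p M f] by simp
  then have "AE x in M. \<bar>f x\<bar> powr p = 0"
    using assms by (subst (asm) integral_nonneg_eq_0_iff_AE) (auto simp: Lp_def)
  then show ?thesis by simp
qed

lemma Lp_mult_integrable:
  assumes "f \<in> Lp M r" "g \<in> Lp M s" "1 < r" "1 < s" "1 / r + 1 / s = 1"
  shows "integrable M (\<lambda>x. f x * g x)"
proof (rule Bochner_Integration.integrable_bound)
  show "integrable M (\<lambda>x. \<bar>f x\<bar> powr r / r + \<bar>g x\<bar> powr s / s)"
    using assms by (auto simp: Lp_def)
  show "AE x in M. norm (f x * g x) \<le> norm (\<bar>f x\<bar> powr r / r + \<bar>g x\<bar> powr s / s)"
    using Youngs_inequality[of r s "\<bar>f x\<bar>" "\<bar>g x\<bar>" for x] assms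
    by (intro AE_I2) (auto simp: abs_mult intro: order_trans)
qed (use assms in \<open>auto simp: Lp_def\<close>)

text \<open>Young's inequality for f and g scaled to norm 1. If one norm is 0, that function
  vanishes almost everywhere and so does the product.\<close>

lemma Holder_inequality:
  assumes f: "f \<in> Lp M r" and g: "g \<in> Lp M s" and rs: "1 < r" "1 < s" "1 / r + 1 / s = 1"
  shows "(\<integral>x. \<bar>f x\<bar> * \<bar>g x\<bar> \<partial>M) \<le> lpnorm M r f * lpnorm M s g"
proof (cases "lpnorm M r f = 0 \<or> lpnorm M s g = 0")
  case True
  then have "(AE x in M. f x = 0) \<or> (AE x in M. g x = 0)"
    using Lp_eq_0_AE[OF f] Lp_eq_0_AE[OF g] rs by auto
  then have "AE x in M. \<bar>f x\<bar> * \<bar>g x\<bar> = 0" by auto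
  then have "(\<integral>x. \<bar>f x\<bar> * \<bar>g x\<bar> \<partial>M) = 0" by (rule integral_eq_zero_AE)
  then show ?thesis by simp
next
  case False
  define a where "a = lpnorm M r f"
  define b where "b = lpnorm M s g"
  have ab: "0 < a" "0 < b"
    using False lpnorm_nonneg[of M r f] lpnorm_nonneg[of M s g]
    unfolding a_def b_def by linarith+
  have "\<bar>f x\<bar> * \<bar>g x\<bar> \<le> a * b * (\<bar>f x\<bar> powr r / (a powr r * r) + \<bar>g x\<bar> powr s / (b powr s * s))" for x
  proof -
    have "(\<bar>f x\<bar> / a) * (\<bar>g x\<bar> / b) \<le> (\<bar>f x\<bar> / a) powr r / r + (\<bar>g x\<bar> / b) powr s / s"
      using ab rs by (intro Youngs_inequality) auto
    then show ?thesis using ab by (simp add: powr_divide field_simps)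
  qed
  moreover have "integrable M (\<lambda>x. \<bar>f x\<bar> * \<bar>g x\<bar>)"
    using integrable_abs[OF Lp_mult_integrable[OF assms]] by (simp add: abs_mult)
  ultimately have "(\<integral>x. \<bar>f x\<bar> * \<bar>g x\<bar> \<partial>M)
      \<le> (\<integral>x. a * b * (\<bar>f x\<bar> powr r / (a powr r * r) + \<bar>g x\<bar> powr s / (b powr s * s)) \<partial>M)"
    using f g by (intro integral_mono) (auto simp: Lp_def)
  also have "\<dots> = a * b * ((\<integral>x. \<bar>f x\<bar> powr r \<partial>M) / (a powr r * r)
      + (\<integral>x. \<bar>g x\<bar> powr s \<partial>M) / (b powr s * s))"
    using f g by (simp add: Lp_def)
  also have "\<dots> = a * b * (1 / r + 1 / s)"
  proof -
    have "(\<integral>x. \<bar>f x\<bar> powr r \<partial>M) = a powr r" "(\<integral>x. \<bar>g x\<bar> powr s \<partial>M) = b powr s"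
      using rs by (auto simp: a_def b_def lpnorm_powr)
    then show ?thesis using ab by simp
  qed
  also have "\<dots> = a * b" using rs by simp
  finally show ?thesis by (simp add: a_def b_def)
qed

text \<open>Cauchy-Schwarz for |f|^q and |g|^q, whose squares are the powers 2q.\<close>

lemma lpnorm_mult_le:
  assumes f: "f \<in> Lp M (2 * q)" and g: "g \<in> Lp M (2 * q)" and q: "0 < q"
  shows "(\<lambda>x. f x * g x) \<in> Lp M q" "lpnorm M q (\<lambda>x. f x * g x) \<le> lpnorm M (2 * q) f * lpnorm M (2 * q) g"
proof -
  let ?F = "\<lambda>x. \<bar>f x\<bar> powr q" and ?G = "\<lambda>x. \<bar>g x\<bar> powr q"
  have F: "?F \<in> Lp M 2" "?G \<in> Lp M 2"
    using f g by (auto simp: Lp_def powr_powr mult.commute simp del: powr_numeral)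
  have "integrable M (\<lambda>x. ?F x * ?G x)"
    using F by (intro Lp_mult_integrable) auto
  then show "(\<lambda>x. f x * g x) \<in> Lp M q"
    using f g by (auto simp: Lp_def abs_mult powr_mult)
  have *: "lpnorm M 2 (\<lambda>x. \<bar>h x\<bar> powr q) = lpnorm M (2 * q) h powr q" for h
    using q by (simp add: lpnorm_def powr_powr mult.commute del: powr_numeral)
  have "(\<integral>x. \<bar>f x * g x\<bar> powr q \<partial>M) = (\<integral>x. \<bar>?F x\<bar> * \<bar>?G x\<bar> \<partial>M)"
    by (simp add: abs_mult powr_mult)
  also have "\<dots> \<le> lpnorm M 2 ?F * lpnorm M 2 ?G"
    using F by (intro Holder_inequality) auto
  also have "\<dots> = (lpnorm M (2 * q) f * lpnorm M (2 * q) g) powr q"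
    by (simp add: * powr_mult)
  finally show "lpnorm M q (\<lambda>x. f x * g x) \<le> lpnorm M (2 * q) f * lpnorm M (2 * q) g"
    using q by (intro lpnorm_le) auto
qed

text \<open>Hoelder with the conjugate exponents a/(a-2) and a/2. It controls the mixed term of
  \<open>abs_add_powr_le_ge2\<close>.\<close>

lemma integral_powr_mult_square_le:
  assumes f: "f \<in> Lp M a" and g: "g \<in> Lp M a" and a: "2 < a"
  shows "integrable M (\<lambda>x. \<bar>f x\<bar> powr (a - 2) * (g x)\<^sup>2)"
    "(\<integral>x. \<bar>f x\<bar> powr (a - 2) * (g x)\<^sup>2 \<partial>M) \<le> lpnorm M a f powr (a - 2) * (lpnorm M a g)\<^sup>2"
proof -
  let ?F = "\<lambda>x. \<bar>f x\<bar> powr (a - 2)" and ?G = "\<lambda>x. (g x)\<^sup>2"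
  have g2: "(g x)\<^sup>2 = \<bar>g x\<bar> powr 2" for x by simp
  have rs: "1 < a / (a - 2)" "1 < a / 2" "1 / (a / (a - 2)) + 1 / (a / 2) = 1"
    using a by (auto simp: field_simps)
  have F: "?F \<in> Lp M (a / (a - 2))" "?G \<in> Lp M (a / 2)"
    using f g a unfolding g2 by (auto simp: Lp_def powr_powr simp del: powr_numeral)
  show "integrable M (\<lambda>x. ?F x * ?G x)"
    using F rs by (intro Lp_mult_integrable) auto
  have "(\<integral>x. ?F x * ?G x \<partial>M) = (\<integral>x. \<bar>?F x\<bar> * \<bar>?G x\<bar> \<partial>M)" by simp
  also have "\<dots> \<le> lpnorm M (a / (a - 2)) ?F * lpnorm M (a / 2) ?G"
    using F rs by (intro Holder_inequality) auto
  also have "lpnorm M (a / (a - 2)) ?F = lpnorm M a f powr (a - 2)"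
    using a by (simp add: lpnorm_def powr_powr)
  also have "lpnorm M (a / 2) ?G = lpnorm M a g powr 2"
    using a unfolding g2 by (simp add: lpnorm_def powr_powr del: powr_numeral)
  finally show "(\<integral>x. ?F x * ?G x \<partial>M) \<le> lpnorm M a f powr (a - 2) * (lpnorm M a g)\<^sup>2"
    by simp
qed

text \<open>Minkowski by convexity: (f + g)/(a + b) is the convex combination of f/a and g/b with
  weights a/(a + b) and b/(a + b), where a and b are slightly larger than the two norms.\<close>

lemma lpnorm_add_le:
  assumes f: "f \<in> Lp M p" and g: "g \<in> Lp M p" and p: "1 < p"
  shows "lpnorm M p (\<lambda>x. f x + g x) \<le> lpnorm M p f + lpnorm M p g"
proof (rule field_le_epsilon)
  fix e :: real assume "0 < e"
  \<comment> \<open>The slack \<open>e / 2\<close> keeps both scales positive even when a norm is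
    0.\<close>
  define a where "a = lpnorm M p f + e / 2"
  define b where "b = lpnorm M p g + e / 2"
  have ab: "0 < a" "0 < b" using \<open>0 < e\<close> by (auto simp: a_def b_def add_nonneg_pos)
  have If: "(\<integral>x. \<bar>f x\<bar> powr p \<partial>M) \<le> a powr p"
    using \<open>0 < e\<close> p by (subst lpnorm_powr[symmetric]) (auto intro!: powr_mono2 simp: a_def)
  have Ig: "(\<integral>x. \<bar>g x\<bar> powr p \<partial>M) \<le> b powr p"
    using \<open>0 < e\<close> p by (subst lpnorm_powr[symmetric]) (auto intro!: powr_mono2 simp: b_def)
  have "\<bar>f x + g x\<bar> powr p \<le> (a + b) powr p
      * (a / (a + b) * (\<bar>f x\<bar> powr p / a powr p) + b / (a + b) * (\<bar>g x\<bar> powr p / b powr p))" for x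
  proof -
    have conv: "\<bar>u * x + v * y\<bar> powr p \<le> u * \<bar>x\<bar> powr p + v * \<bar>y\<bar> powr p"
      if "0 \<le> u" "0 \<le> v" "u + v = 1" for u v x y :: real
      using convex_on_abs_powr[OF p] that unfolding convex_on_def by auto
    have "\<bar>a / (a + b) * (f x / a) + b / (a + b) * (g x / b)\<bar> powr p
        \<le> a / (a + b) * \<bar>f x / a\<bar> powr p + b / (a + b) * \<bar>g x / b\<bar> powr p"
      using ab by (intro conv) (auto simp: add_divide_distrib[symmetric])
    moreover have "a / (a + b) * (f x / a) + b / (a + b) * (g x / b) = (f x + g x) / (a + b)"
      using ab by (simp add: add_divide_distrib)
    ultimately have "\<bar>f x + g x\<bar> powr p / (a + b) powr p
        \<le> a / (a + b) * (\<bar>f x\<bar> powr p / a powr p) + b / (a + b) * (\<bar>g x\<bar> powr p / b powr p)"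
      using ab by (simp add: powr_divide abs_divide)
    then show ?thesis using ab by (subst mult.commute) (subst pos_divide_le_eq[symmetric], auto)
  qed
  moreover have "integrable M (\<lambda>x. \<bar>f x + g x\<bar> powr p)"
    using Lp_add[OF f g] p by (simp add: Lp_def)
  ultimately have "(\<integral>x. \<bar>f x + g x\<bar> powr p \<partial>M) \<le> (\<integral>x. (a + b) powr p
      * (a / (a + b) * (\<bar>f x\<bar> powr p / a powr p) + b / (a + b) * (\<bar>g x\<bar> powr p / b powr p)) \<partial>M)"
    using f g by (intro integral_mono) (auto simp: Lp_def)
  also have "\<dots> = (a + b) powr p * (a / (a + b) * ((\<integral>x. \<bar>f x\<bar> powr p \<partial>M) / a powr p)
      + b / (a + b) * ((\<integral>x. \<bar>g x\<bar> powr p \<partial>M) / b powr p))"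
    using f g by (simp add: Lp_def)
  also have "\<dots> \<le> (a + b) powr p * (a / (a + b) * 1 + b / (a + b) * 1)"
    using If Ig ab by (intro mult_left_mono add_mono) auto
  also have "\<dots> = (a + b) powr p"
    using ab by (simp add: add_divide_distrib[symmetric])
  finally have "lpnorm M p (\<lambda>x. f x + g x) \<le> a + b"
    using ab p by (intro lpnorm_le) auto
  then show "lpnorm M p (\<lambda>x. f x + g x) \<le> lpnorm M p f + lpnorm M p g + e"
    by (simp add: a_def b_def)
qed

lemma lpnorm_sum_le:
  assumes "\<And>i. i \<in> I \<Longrightarrow> f i \<in> Lp M p" "1 < p"
  shows "lpnorm M p (\<lambda>x. \<Sum>i\<in>I. f i x) \<le> (\<Sum>i\<in>I. lpnorm M p (f i))"
  using assms(1)
proof (induction I rule: infinite_finite_induct)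
  case (insert i I)
  then have "lpnorm M p (\<lambda>x. f i x + (\<Sum>i\<in>I. f i x)) \<le> lpnorm M p (f i) + lpnorm M p (\<lambda>x. \<Sum>i\<in>I. f i x)"
    using assms(2) by (intro lpnorm_add_le Lp_sum) auto
  then show ?case using insert by force
qed (auto simp: lpnorm_def)

lemma Lp_distr_iff:
  assumes "T \<in> measurable M N" "f \<in> borel_measurable N"
  shows "f \<in> Lp (distr M N T) p \<longleftrightarrow> (\<lambda>x. f (T x)) \<in> Lp M p"
proof -
  have [measurable]: "T \<in> measurable M N" "f \<in> borel_measurable N" by fact+
  have "(\<lambda>x. f (T x)) \<in> borel_measurable M" "(\<lambda>x. \<bar>f x\<bar> powr p) \<in> borel_measurable N"
    by measurable
  then show ?thesis
    using assms integrable_distr_eq[of T M N "\<lambda>x. \<bar>f x\<bar> powr p"]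
    by (simp add: Lp_def)
qed

lemma lpnorm_distr:
  assumes "T \<in> measurable M N" "f \<in> borel_measurable N"
  shows "lpnorm (distr M N T) p f = lpnorm M p (\<lambda>x. f (T x))"
proof -
  have [measurable]: "T \<in> measurable M N" "f \<in> borel_measurable N" by fact+
  have "(\<lambda>x. \<bar>f x\<bar> powr p) \<in> borel_measurable N" by measurable
  then show ?thesis
    unfolding lpnorm_def using assms(1) by (simp add: integral_distr)
qed

section \<open>Moment inequalities for martingale differences\<close>

lemma sgn_powr_mult_integrable:
  assumes f: "f \<in> Lp M q" and g: "g \<in> Lp M q" and q: "1 < q"
  shows "integrable M (\<lambda>x. sgn_powr (q - 1) (f x) * g x)"
proof (rule Bochner_Integration.integrable_bound)
  have [measurable]: "f \<in> borel_measurable M" "g \<in> borel_measurable M"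
    using f g by (auto simp: Lp_def)
  show "integrable M (\<lambda>x. \<bar>f x\<bar> powr q + \<bar>g x\<bar> powr q)"
    using f g by (auto simp: Lp_def)
  show "AE x in M. norm (sgn_powr (q - 1) (f x) * g x) \<le> norm (\<bar>f x\<bar> powr q + \<bar>g x\<bar> powr q)"
    using powr_mult_powr_le[of "\<bar>f x\<bar>" "\<bar>g x\<bar>" "q - 1" 1 for x] q by (intro AE_I2) (simp add: abs_mult)
  show "(\<lambda>x. sgn_powr (q - 1) (f x) * g x) \<in> borel_measurable M" by measurable
qed

text \<open>The martingale property enters only as \<open>orth\<close>: the increment is orthogonal
  to the signed power of the current value, so the linear term of \<open>abs_add_powr_le\<close>
  disappears on integration and induction adds up the remainders.\<close>

lemma von_Bahr_Esseen:
  fixes S :: "nat \<Rightarrow> 'a \<Rightarrow> real"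
  assumes q: "1 < q" "q \<le> 2"
    and S: "\<And>n. S n \<in> Lp M q" and S0: "\<And>x. S 0 x = 0"
    and orth: "\<And>n. (\<integral>x. sgn_powr (q - 1) (S n x) * (S (Suc n) x - S n x) \<partial>M) = 0"
  shows "(\<integral>x. \<bar>S n x\<bar> powr q \<partial>M) \<le> 2 * q * (\<Sum>k<n. \<integral>x. \<bar>S (Suc k) x - S k x\<bar> powr q \<partial>M)"
proof (induction n)
  case (Suc n)
  let ?D = "\<lambda>x. S (Suc n) x - S n x"
  have D: "?D \<in> Lp M q" using S q by (intro Lp_diff) auto
  have I: "integrable M (\<lambda>x. sgn_powr (q - 1) (S n x) * ?D x)"
    using S D q by (intro sgn_powr_mult_integrable) auto
  have "(\<integral>x. \<bar>S (Suc n) x\<bar> powr q \<partial>M)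
      \<le> (\<integral>x. \<bar>S n x\<bar> powr q + q * (sgn_powr (q - 1) (S n x) * ?D x) + 2 * q * \<bar>?D x\<bar> powr q \<partial>M)"
  proof (intro integral_mono)
    show "\<bar>S (Suc n) x\<bar> powr q \<le> \<bar>S n x\<bar> powr q + q * (sgn_powr (q - 1) (S n x) * ?D x) + 2 * q * \<bar>?D x\<bar> powr q" for x
      using abs_add_powr_le[OF q, of "S n x" "?D x"] by (simp add: mult.assoc)
  qed (use S[of n] S[of "Suc n"] D I in \<open>auto simp: Lp_def\<close>)
  also have "\<dots> = (\<integral>x. \<bar>S n x\<bar> powr q \<partial>M) + 2 * q * (\<integral>x. \<bar>?D x\<bar> powr q \<partial>M)"
    using S[of n] D I orth[of n] by (simp add: Lp_def)
  finally show ?case using Suc by (simp add: algebra_simps)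
qed (simp add: S0)

text \<open>Arithmetic of the induction step of \<open>Rio_inequality\<close>, with s the norm so
  far, d the norm of the new increment and t the sum of squared earlier norms. With r = a/2
  everything becomes a power of squares, and the claim follows from t^(r-1) \<le> (t + D)^(r-1) for
  D = d^2.\<close>

lemma powr_step_le:
  fixes s t d K C a :: real
  assumes a: "2 < a" and "0 \<le> s" "s\<^sup>2 \<le> K * t" "0 \<le> t" "0 \<le> d" "1 \<le> C" and K: "K = 2 * C"
  shows "s powr a + C * (s powr (a - 2) * d\<^sup>2 + d powr a) \<le> (K * (t + d\<^sup>2)) powr (a / 2)"
proof -
  define r where "r = a / 2"
  have r: "1 < r" "a = 2 * r" using a by (auto simp: r_def)
  have sq: "x powr a = (x\<^sup>2) powr r" "x powr (a - 2) = (x\<^sup>2) powr (r - 1)" if "0 \<le> x" for x :: real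
    using that r by (auto simp: powr_powr right_diff_distrib simp flip: powr_numeral)
  define D where "D = d\<^sup>2"
  have D: "0 \<le> D" by (simp add: D_def)
  have K1: "2 \<le> K" "0 < K" using assms by auto
  have split: "x powr r = x powr (r - 1) * x" if "0 \<le> x" for x :: real
    using that powr_mult_base[of x "r - 1"] by (simp add: mult.commute)
  have "s powr a + C * (s powr (a - 2) * d\<^sup>2 + d powr a)
      \<le> (K * t) powr r + C * ((K * t) powr (r - 1) * D + D powr r)"
    unfolding sq[OF assms(2)] sq[OF assms(5)] D_def[symmetric]
    using assms r D by (intro add_mono mult_left_mono mult_right_mono powr_mono2) auto
  also have "\<dots> = K powr r * t powr r + C * K powr (r - 1) * t powr (r - 1) * D + C * D powr r"
    by (simp add: powr_mult algebra_simps)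
  \<comment> \<open>The choice K = 2C is made for this identity.\<close>
  also have "C * K powr (r - 1) = K powr r / 2"
    using K1 K split[of K] by simp
  also have "K powr r * t powr r + K powr r / 2 * t powr (r - 1) * D + C * D powr r
      \<le> K powr r * t powr r + K powr r / 2 * t powr (r - 1) * D + K powr r / 2 * D powr r"
  proof -
    have "C = K powr 1 / 2" using K1 K by simp
    also have "\<dots> \<le> K powr r / 2" using K1 r by (intro divide_right_mono powr_mono) auto
    finally have "C * D powr r \<le> K powr r / 2 * D powr r" by (intro mult_right_mono) auto
    then show ?thesis by simp
  qed
  also have "\<dots> = K powr r * (t powr r + (t powr (r - 1) * D + D powr (r - 1) * D) / 2)"
    using split[OF D] by (simp add: algebra_simps)
  \<comment> \<open>Each power r - 1 is moved to the larger base t + D; the two halves of D then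
    recombine to (t + D)^r.\<close>
  also have "\<dots> \<le> K powr r * ((t + D) powr (r - 1) * t + ((t + D) powr (r - 1) * D + (t + D) powr (r - 1) * D) / 2)"
    using assms r D split[OF assms(4)]
    by (intro mult_left_mono add_mono divide_right_mono mult_right_mono) (auto intro!: mult_right_mono powr_mono2)
  also have "\<dots> = K powr r * ((t + D) powr (r - 1) * (t + D))"
    by (simp add: algebra_simps)
  also have "\<dots> = (K * (t + D)) powr r"
    using split[of "t + D"] assms D by (simp only: powr_mult)
  finally show ?thesis by (simp add: r_def D_def)
qed

text \<open>Induction on the squared norm. The constant is twice that of
  \<open>abs_add_powr_le_ge2\<close>, as \<open>powr_step_le\<close> requires. Adding squares of
  norms rather than a-th powers is what later gives block sums of square-root size.\<close>

lemma Rio_inequality: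
  fixes S :: "nat \<Rightarrow> 'a \<Rightarrow> real"
  assumes a: "2 < a"
    and S: "\<And>n. S n \<in> Lp M a" and S0: "\<And>x. S 0 x = 0"
    and orth: "\<And>n. (\<integral>x. sgn_powr (a - 1) (S n x) * (S (Suc n) x - S n x) \<partial>M) = 0"
  shows "(lpnorm M a (S n))\<^sup>2 \<le> 4 * a * a * 2 powr a * (\<Sum>k<n. (lpnorm M a (\<lambda>x. S (Suc k) x - S k x))\<^sup>2)"
proof (induction n)
  case 0
  have "lpnorm M a (S 0) = 0" by (simp add: lpnorm_def S0)
  then show ?case by simp
next
  case (Suc n)
  let ?D = "\<lambda>x. S (Suc n) x - S n x"
  define C where "C = 2 * a * a * 2 powr a"
  define t where "t = (\<Sum>k<n. (lpnorm M a (\<lambda>x. S (Suc k) x - S k x))\<^sup>2)"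
  have "1 * 1 \<le> a * a" using a by (intro mult_mono) auto
  then have "1 * 1 \<le> (2 * a * a) * 2 powr a"
    using a by (intro mult_mono ge_one_powr_ge_zero) auto
  then have C: "1 \<le> C" by (simp add: C_def)
  have D: "?D \<in> Lp M a" using S a by (intro Lp_diff) auto
  have I: "integrable M (\<lambda>x. sgn_powr (a - 1) (S n x) * ?D x)"
    using S D a by (intro sgn_powr_mult_integrable) auto
  note J = integral_powr_mult_square_le[OF S[of n] D a]
  have "(\<integral>x. \<bar>S (Suc n) x\<bar> powr a \<partial>M)
      \<le> (\<integral>x. \<bar>S n x\<bar> powr a + a * (sgn_powr (a - 1) (S n x) * ?D x)
          + C * (\<bar>S n x\<bar> powr (a - 2) * (?D x)\<^sup>2 + \<bar>?D x\<bar> powr a) \<partial>M)"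
  proof (intro integral_mono)
    show "\<bar>S (Suc n) x\<bar> powr a \<le> \<bar>S n x\<bar> powr a + a * (sgn_powr (a - 1) (S n x) * ?D x)
          + C * (\<bar>S n x\<bar> powr (a - 2) * (?D x)\<^sup>2 + \<bar>?D x\<bar> powr a)" for x
      using abs_add_powr_le_ge2[OF a, of "S n x" "?D x"] by (simp add: mult.assoc C_def)
  qed (use S[of n] S[of "Suc n"] D I J in \<open>auto simp: Lp_def\<close>)
  also have "\<dots> = (\<integral>x. \<bar>S n x\<bar> powr a \<partial>M)
      + C * ((\<integral>x. \<bar>S n x\<bar> powr (a - 2) * (?D x)\<^sup>2 \<partial>M) + (\<integral>x. \<bar>?D x\<bar> powr a \<partial>M))"
    using S[of n] D I J orth[of n] by (simp add: Lp_def)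
  also have "\<dots> \<le> lpnorm M a (S n) powr a
      + C * (lpnorm M a (S n) powr (a - 2) * (lpnorm M a ?D)\<^sup>2 + lpnorm M a ?D powr a)"
    using J C a by (intro add_mono mult_left_mono) (auto simp: lpnorm_powr)
  also have "\<dots> \<le> (2 * C * (t + (lpnorm M a ?D)\<^sup>2)) powr (a / 2)"
    using Suc C a by (intro powr_step_le) (auto simp: C_def t_def sum_nonneg)
  \<comment> \<open>Written as an a-th power so that \<open>lpnorm_le\<close> can extract the
    norm.\<close>
  also have "\<dots> = sqrt (2 * C * (t + (lpnorm M a ?D)\<^sup>2)) powr a"
    using C by (simp add: t_def sum_nonneg powr_powr flip: powr_half_sqrt)
  finally have "lpnorm M a (S (Suc n)) \<le> sqrt (2 * C * (t + (lpnorm M a ?D)\<^sup>2))"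
    using a C by (intro lpnorm_le) (auto simp: t_def sum_nonneg)
  then have "(lpnorm M a (S (Suc n)))\<^sup>2 \<le> 2 * C * (t + (lpnorm M a ?D)\<^sup>2)"
    using C sqrt_ge_absD by fastforce
  then show ?case by (simp add: C_def t_def algebra_simps)
qed

section \<open>Independent sequences\<close>

text \<open>Integrating out one factor is a contraction: Jensen's inequality on almost every fibre,
  then Fubini.\<close>

lemma Lp_fibre_integral:
  assumes "prob_space A" "prob_space B" and F: "F \<in> Lp (A \<Otimes>\<^sub>M B) q" and q: "1 < q"
  shows "(\<lambda>x. \<integral>y. F (x, y) \<partial>B) \<in> Lp A q"
    and "(\<integral>x. \<bar>\<integral>y. F (x, y) \<partial>B\<bar> powr q \<partial>A) \<le> (\<integral>z. \<bar>F z\<bar> powr q \<partial>(A \<Otimes>\<^sub>M B))"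
    and "AE x in A. integrable B (\<lambda>y. F (x, y))"
proof -
  interpret A: prob_space A by fact
  interpret B: prob_space B by fact
  interpret AB: pair_prob_space A B ..
  have [measurable]: "F \<in> borel_measurable (A \<Otimes>\<^sub>M B)" using F by (simp add: Lp_def)
  have Fi: "integrable (A \<Otimes>\<^sub>M B) F" using AB.Lp_integrable[OF F] q by simp
  have Fq: "integrable (A \<Otimes>\<^sub>M B) (\<lambda>z. \<bar>F z\<bar> powr q)" using F by (simp add: Lp_def)
  have I: "integrable A (\<lambda>x. \<integral>y. \<bar>F (x, y)\<bar> powr q \<partial>B)"
    using AB.integrable_fst'[OF Fq] .
  have AE: "AE x in A. integrable B (\<lambda>y. \<bar>F (x, y)\<bar> powr q)"
    using AB.AE_integrable_fst'[OF Fq] .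
  have le: "AE x in A. \<bar>\<integral>y. F (x, y) \<partial>B\<bar> powr q \<le> (\<integral>y. \<bar>F (x, y)\<bar> powr q \<partial>B)"
    using AE AE_space
  proof eventually_elim
    case (elim x)
    then have "(\<lambda>y. F (x, y)) \<in> Lp B q" by (auto simp: Lp_def)
    then show ?case by (rule B.abs_expectation_powr_le[OF _ q])
  qed
  have I2: "integrable A (\<lambda>x. \<bar>\<integral>y. F (x, y) \<partial>B\<bar> powr q)"
  proof (rule Bochner_Integration.integrable_bound[OF I])
    show "AE x in A. norm (\<bar>\<integral>y. F (x, y) \<partial>B\<bar> powr q) \<le> norm (\<integral>y. \<bar>F (x, y)\<bar> powr q \<partial>B)"
      using le by eventually_elim simp
  qed measurable
  then show "(\<lambda>x. \<integral>y. F (x, y) \<partial>B) \<in> Lp A q" by (simp add: Lp_def)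
  show "AE x in A. integrable B (\<lambda>y. F (x, y))"
    using AB.AE_integrable_fst'[OF Fi] .
  have "(\<integral>x. \<bar>\<integral>y. F (x, y) \<partial>B\<bar> powr q \<partial>A) \<le> (\<integral>x. \<integral>y. \<bar>F (x, y)\<bar> powr q \<partial>B \<partial>A)"
    using I2 I le by (rule integral_mono_AE)
  also have "\<dots> = (\<integral>z. \<bar>F z\<bar> powr q \<partial>(A \<Otimes>\<^sub>M B))"
    using AB.integral_fst'[OF Fq] .
  finally show "(\<integral>x. \<bar>\<integral>y. F (x, y) \<partial>B\<bar> powr q \<partial>A) \<le> (\<integral>z. \<bar>F z\<bar> powr q \<partial>(A \<Otimes>\<^sub>M B))" .
qed

text \<open>Testing against indicators suffices. This form turns equality of laws into a Tonelli
  computation with no integrability conditions.\<close>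

lemma distr_eqI_nn_integral:
  assumes T: "T \<in> measurable M N" and "sets N' = sets N"
    and "\<And>f. f \<in> borel_measurable N \<Longrightarrow> (\<integral>\<^sup>+x. f (T x) \<partial>M) = (\<integral>\<^sup>+x. f x \<partial>N')"
  shows "distr M N T = N'"
proof (rule measure_eqI)
  fix X assume "X \<in> sets (distr M N T)"
  then have [measurable]: "X \<in> sets N" by simp
  have "emeasure (distr M N T) X = (\<integral>\<^sup>+x. indicator X x \<partial>distr M N T)" by simp
  also have "\<dots> = (\<integral>\<^sup>+x. indicator X (T x) \<partial>M)"
    using T by (subst nn_integral_distr) auto
  also have "\<dots> = (\<integral>\<^sup>+x. indicator X x \<partial>N')" by (rule assms(3)) measurable
  also have "\<dots> = emeasure N' X" using assms(2) by simp
  finally show "emeasure (distr M N T) X = emeasure N' X" .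
qed (use assms in simp)

lemma distr_snd_prob:
  assumes "prob_space A" "sigma_finite_measure B"
  shows "distr (A \<Otimes>\<^sub>M B) B snd = B"
proof (rule distr_eqI_nn_integral)
  interpret A: prob_space A by fact
  interpret B: sigma_finite_measure B by fact
  fix f :: "'b \<Rightarrow> ennreal" assume [measurable]: "f \<in> borel_measurable B"
  have "(\<integral>\<^sup>+z. f (snd z) \<partial>(A \<Otimes>\<^sub>M B)) = (\<integral>\<^sup>+x. \<integral>\<^sup>+y. f y \<partial>B \<partial>A)"
    by (subst B.nn_integral_fst[symmetric]) auto
  then show "(\<integral>\<^sup>+z. f (snd z) \<partial>(A \<Otimes>\<^sub>M B)) = (\<integral>\<^sup>+y. f y \<partial>B)"
    by (simp add: A.emeasure_space_1)
qed auto

section \<open>Splicing, resampling and tail averages of an i.i.d. sequence\<close>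

context sequence_space
begin

lemma prob_space_M: "prob_space M"
  by (rule prob_space)

lemma prob_space_S: "prob_space S"
  by (rule P.prob_space_axioms)

lemma measurable_upd [measurable (raw)]:
  assumes "f \<in> measurable N S" "e \<in> measurable N M"
  shows "(\<lambda>x. (f x)(k := e x)) \<in> measurable N S"
  using assms by (intro measurable_fun_upd[where J = UNIV]) auto

lemma nn_integral_comb_seq:
  assumes [measurable]: "f \<in> borel_measurable S"
  shows "(\<integral>\<^sup>+x. \<integral>\<^sup>+y. f (comb_seq k x y) \<partial>S \<partial>S) = (\<integral>\<^sup>+x. f x \<partial>S)"
proof -
  have "(\<integral>\<^sup>+x. f x \<partial>S) = (\<integral>\<^sup>+x. f x \<partial>distr (S \<Otimes>\<^sub>M S) S (\<lambda>(\<omega>, \<omega>'). comb_seq k \<omega> \<omega>'))"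
    by (simp add: PiM_comb_seq)
  also have "\<dots> = (\<integral>\<^sup>+z. f (comb_seq k (fst z) (snd z)) \<partial>(S \<Otimes>\<^sub>M S))"
    by (subst nn_integral_distr) (auto simp: split_beta')
  also have "\<dots> = (\<integral>\<^sup>+x. \<integral>\<^sup>+y. f (comb_seq k x y) \<partial>S \<partial>S)"
    by (subst P.nn_integral_fst[symmetric]) auto
  finally show ?thesis by simp
qed

lemma nn_integral_case_nat:
  assumes [measurable]: "f \<in> borel_measurable S"
  shows "(\<integral>\<^sup>+e. \<integral>\<^sup>+y. f (case_nat e y) \<partial>S \<partial>M) = (\<integral>\<^sup>+x. f x \<partial>S)"
proof -
  have "(\<integral>\<^sup>+x. f x \<partial>S) = (\<integral>\<^sup>+x. f x \<partial>distr (M \<Otimes>\<^sub>M S) S (\<lambda>(s, \<omega>). case_nat s \<omega>))"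
    by (simp add: PiM_iter)
  also have "\<dots> = (\<integral>\<^sup>+z. f (case_nat (fst z) (snd z)) \<partial>(M \<Otimes>\<^sub>M S))"
    by (subst nn_integral_distr) (auto simp: split_beta')
  also have "\<dots> = (\<integral>\<^sup>+e. \<integral>\<^sup>+y. f (case_nat e y) \<partial>S \<partial>M)"
    by (subst P.nn_integral_fst[symmetric]) auto
  finally show ?thesis by simp
qed

text \<open>Splicing two independent copies gives a sequence of law \<open>S\<close> that is still
  independent of the fresh value \<open>e\<close>. Keeping \<open>x\<close> as the outer factor
  prepares the fibre integral over \<open>(e, y)\<close> in
  \<open>tail_avg_increment_le\<close>.\<close>

lemma distr_split_at:
  "distr (S \<Otimes>\<^sub>M (M \<Otimes>\<^sub>M S)) (M \<Otimes>\<^sub>M S) (\<lambda>(x, e, y). (e, comb_seq k x y)) = M \<Otimes>\<^sub>M S"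
proof (rule distr_eqI_nn_integral)
  interpret M: prob_space M by (rule prob_space_M)
  interpret SM: pair_prob_space S M ..
  interpret MS: pair_prob_space M S ..
  fix f :: "'a \<times> (nat \<Rightarrow> 'a) \<Rightarrow> ennreal" assume [measurable]: "f \<in> borel_measurable (M \<Otimes>\<^sub>M S)"
  have "(\<integral>\<^sup>+z. f (case z of (x, e, y) \<Rightarrow> (e, comb_seq k x y)) \<partial>(S \<Otimes>\<^sub>M (M \<Otimes>\<^sub>M S)))
      = (\<integral>\<^sup>+x. \<integral>\<^sup>+z. f (fst z, comb_seq k x (snd z)) \<partial>(M \<Otimes>\<^sub>M S) \<partial>S)"
    by (subst MS.nn_integral_fst[symmetric]) (auto simp: split_beta')
  also have "\<dots> = (\<integral>\<^sup>+x. \<integral>\<^sup>+e. \<integral>\<^sup>+y. f (e, comb_seq k x y) \<partial>S \<partial>M \<partial>S)"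
    by (intro nn_integral_cong, subst P.nn_integral_fst[symmetric]) auto
  also have "\<dots> = (\<integral>\<^sup>+e. \<integral>\<^sup>+x. \<integral>\<^sup>+y. f (e, comb_seq k x y) \<partial>S \<partial>S \<partial>M)"
    by (rule SM.Fubini'[symmetric]) measurable
  also have "\<dots> = (\<integral>\<^sup>+e. \<integral>\<^sup>+x. f (e, x) \<partial>S \<partial>M)"
    by (intro nn_integral_cong nn_integral_comb_seq) measurable
  also have "\<dots> = (\<integral>\<^sup>+z. f z \<partial>(M \<Otimes>\<^sub>M S))"
    by (subst P.nn_integral_fst[symmetric]) auto
  finally show "(\<integral>\<^sup>+z. f (case z of (x, e, y) \<Rightarrow> (e, comb_seq k x y)) \<partial>(S \<Otimes>\<^sub>M (M \<Otimes>\<^sub>M S)))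
      = (\<integral>\<^sup>+z. f z \<partial>(M \<Otimes>\<^sub>M S))" .
qed (auto simp: split_beta')

text \<open>Overwriting the last entry kept from \<open>x\<close> is the same as keeping one entry
  fewer and starting the tail with \<open>e\<close>. Hence resampling coordinate k turns an average
  over coordinates > k into one over coordinates \<ge> k.\<close>

lemma comb_seq_Suc_upd: "(comb_seq (Suc k) x y)(k := e) = comb_seq k x (case_nat e y)"
  by (auto simp: comb_seq_def fun_eq_iff split: nat.split intro!: arg_cong[where f = y])

text \<open>The sequence is written as a splice at \<open>Suc k\<close>; by
  \<open>comb_seq_Suc_upd\<close> the overwritten entry becomes the head of an independent i.i.d.
  tail.\<close>

lemma distr_upd: "distr (M \<Otimes>\<^sub>M S) S (\<lambda>(e, x). x(k := e)) = S"
proof -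
  interpret M: prob_space M by (rule prob_space_M)
  interpret MS: pair_prob_space M S ..
  have "distr (M \<Otimes>\<^sub>M S) S (\<lambda>(e, x). x(k := e))
      = distr (distr (S \<Otimes>\<^sub>M (M \<Otimes>\<^sub>M S)) (M \<Otimes>\<^sub>M S) (\<lambda>(x, e, y). (e, comb_seq (Suc k) x y))) S (\<lambda>(e, x). x(k := e))"
    by (simp add: distr_split_at)
  also have "\<dots> = distr (S \<Otimes>\<^sub>M (M \<Otimes>\<^sub>M S)) S (\<lambda>z. comb_seq k (fst z) (case_nat (fst (snd z)) (snd (snd z))))"
    by (subst distr_distr) (auto simp: split_beta' comp_def comb_seq_Suc_upd)
  also have "\<dots> = S"
  proof (rule distr_eqI_nn_integral)
    fix f :: "(nat \<Rightarrow> 'a) \<Rightarrow> ennreal" assume [measurable]: "f \<in> borel_measurable S"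
    have "(\<integral>\<^sup>+z. f (comb_seq k (fst z) (case_nat (fst (snd z)) (snd (snd z)))) \<partial>(S \<Otimes>\<^sub>M (M \<Otimes>\<^sub>M S)))
        = (\<integral>\<^sup>+x. \<integral>\<^sup>+z. f (comb_seq k x (case_nat (fst z) (snd z))) \<partial>(M \<Otimes>\<^sub>M S) \<partial>S)"
      by (subst MS.nn_integral_fst[symmetric]) auto
    also have "\<dots> = (\<integral>\<^sup>+x. \<integral>\<^sup>+e. \<integral>\<^sup>+y. f (comb_seq k x (case_nat e y)) \<partial>S \<partial>M \<partial>S)"
      by (intro nn_integral_cong, subst P.nn_integral_fst[symmetric]) auto
    also have "\<dots> = (\<integral>\<^sup>+x. \<integral>\<^sup>+y. f (comb_seq k x y) \<partial>S \<partial>S)"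
      by (intro nn_integral_cong nn_integral_case_nat) measurable
    also have "\<dots> = (\<integral>\<^sup>+x. f x \<partial>S)"
      by (rule nn_integral_comb_seq) measurable
    finally show "(\<integral>\<^sup>+z. f (comb_seq k (fst z) (case_nat (fst (snd z)) (snd (snd z)))) \<partial>(S \<Otimes>\<^sub>M (M \<Otimes>\<^sub>M S)))
        = (\<integral>\<^sup>+x. f x \<partial>S)" .
  qed auto
  finally show ?thesis .
qed

lemma distr_shift: "distr S S (\<lambda>x k. x (j + k)) = S"
proof -
  have [measurable]: "(\<lambda>x k. x (j + k)) \<in> measurable S S"
    by (rule measurable_PiM_single') (auto simp: space_PiM)
  have "distr S S (\<lambda>x k. x (j + k))
      = distr (distr (S \<Otimes>\<^sub>M S) S (\<lambda>(x, y). comb_seq j x y)) S (\<lambda>x k. x (j + k))"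
    by (simp add: PiM_comb_seq)
  also have "\<dots> = distr (S \<Otimes>\<^sub>M S) S snd"
    by (subst distr_distr) (auto simp: comp_def split_beta' comb_seq_def)
  also have "\<dots> = S"
    using prob_space_S P.sigma_finite_measure_axioms by (rule distr_snd_prob)
  finally show ?thesis .
qed

text \<open>A concrete version of the conditional expectation of \<open>Y\<close> given coordinates
  0, ..., k-1.\<close>

definition tail_avg :: "nat \<Rightarrow> ((nat \<Rightarrow> 'a) \<Rightarrow> real) \<Rightarrow> (nat \<Rightarrow> 'a) \<Rightarrow> real" where
  "tail_avg k Y x = (\<integral>y. Y (comb_seq k x y) \<partial>S)"

text \<open>The fresh value \<open>e\<close> is an additional independent coordinate. For Y = g this
  is the physical dependence measure at lag k.\<close>

definition influence :: "real \<Rightarrow> nat \<Rightarrow> ((nat \<Rightarrow> 'a) \<Rightarrow> real) \<Rightarrow> real" where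
  "influence q k Y = lpnorm (M \<Otimes>\<^sub>M S) q (\<lambda>(e, x). Y x - Y (x(k := e)))"

lemma measurable_tail_avg [measurable]:
  assumes [measurable]: "Y \<in> borel_measurable S"
  shows "tail_avg k Y \<in> borel_measurable S"
  unfolding tail_avg_def by measurable

lemma tail_avg_comb_seq: "k \<le> m \<Longrightarrow> tail_avg k Y (comb_seq m x y) = tail_avg k Y x"
proof -
  assume "k \<le> m"
  then have "comb_seq k (comb_seq m x y) z = comb_seq k x z" for z
    by (auto simp: comb_seq_def fun_eq_iff)
  then show ?thesis by (simp add: tail_avg_def)
qed

lemma Lp_comb_seq:
  assumes "Y \<in> Lp S q"
  shows "(\<lambda>z. Y (comb_seq k (fst z) (snd z))) \<in> Lp (S \<Otimes>\<^sub>M S) q"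
proof -
  have "Y \<in> Lp (distr (S \<Otimes>\<^sub>M S) S (\<lambda>(\<omega>, \<omega>'). comb_seq k \<omega> \<omega>')) q"
    using assms by (simp add: PiM_comb_seq)
  then show ?thesis
    using assms by (subst (asm) Lp_distr_iff) (auto simp: split_beta' Lp_def)
qed

lemma Lp_tail_avg:
  assumes "Y \<in> Lp S q" "1 < q"
  shows "tail_avg k Y \<in> Lp S q"
  using Lp_fibre_integral(1)[OF prob_space_S prob_space_S Lp_comb_seq[OF assms(1), of k] assms(2)]
  unfolding tail_avg_def[abs_def] by simp

text \<open>Pull-out property of conditional expectation: for k \<le> m the weight depends only on
  coordinates below m, so it is constant on the fibres over which \<open>tail_avg m\<close>
  averages.\<close>

lemma integral_tail_avg_mult:
  assumes [measurable]: "Y \<in> borel_measurable S" "h \<in> borel_measurable borel"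
    and int: "integrable S (\<lambda>x. h (tail_avg k Y x) * Y x)" and km: "k \<le> m"
  shows "(\<integral>x. h (tail_avg k Y x) * tail_avg m Y x \<partial>S) = (\<integral>x. h (tail_avg k Y x) * Y x \<partial>S)"
proof -
  interpret SS: pair_prob_space S S ..
  let ?f = "\<lambda>x. h (tail_avg k Y x) * Y x"
  let ?T = "\<lambda>(\<omega>, \<omega>'). comb_seq m \<omega> \<omega>'"
  have D: "distr (S \<Otimes>\<^sub>M S) S ?T = S" by (rule PiM_comb_seq)
  have i: "integrable (S \<Otimes>\<^sub>M S) (\<lambda>z. ?f (?T z))"
    using int integrable_distr_eq[of ?T "S \<Otimes>\<^sub>M S" S ?f] unfolding D by simp
  have "(\<integral>x. ?f x \<partial>S) = (\<integral>z. ?f (?T z) \<partial>(S \<Otimes>\<^sub>M S))"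
    using integral_distr[of ?T "S \<Otimes>\<^sub>M S" S ?f] unfolding D by simp
  also have "\<dots> = (\<integral>x. \<integral>y. ?f (?T (x, y)) \<partial>S \<partial>S)"
    by (rule SS.integral_fst'[OF i, symmetric])
  also have "\<dots> = (\<integral>x. \<integral>y. h (tail_avg k Y x) * Y (comb_seq m x y) \<partial>S \<partial>S)"
    using km by (simp add: tail_avg_comb_seq)
  also have "\<dots> = (\<integral>x. h (tail_avg k Y x) * tail_avg m Y x \<partial>S)"
    by (simp add: tail_avg_def)
  finally show ?thesis by simp
qed

lemma Lp_influence:
  assumes "Y \<in> Lp S q" "0 \<le> q"
  shows "(\<lambda>(e, x). Y x - Y (x(k := e))) \<in> Lp (M \<Otimes>\<^sub>M S) q"
proof -
  have [measurable]: "Y \<in> borel_measurable S" using assms by (simp add: Lp_def)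
  have "Y \<in> Lp (distr (M \<Otimes>\<^sub>M S) S snd) q"
    using assms distr_snd_prob[OF prob_space_M P.sigma_finite_measure_axioms] by simp
  then have 1: "(\<lambda>z. Y (snd z)) \<in> Lp (M \<Otimes>\<^sub>M S) q"
    by (subst (asm) Lp_distr_iff) auto
  have "Y \<in> Lp (distr (M \<Otimes>\<^sub>M S) S (\<lambda>(e, x). x(k := e))) q"
    using assms by (simp add: distr_upd)
  then have 2: "(\<lambda>z. Y ((snd z)(k := fst z))) \<in> Lp (M \<Otimes>\<^sub>M S) q"
    by (subst (asm) Lp_distr_iff) (auto simp: split_beta')
  show ?thesis
    using Lp_diff[OF 1 2 assms(2)] by (simp add: split_beta')
qed

text \<open>The increment is a fibre integral of Y minus its resampled version, both at the splice
  at \<open>Suc k\<close>: averaging over the tail gives \<open>tail_avg (Suc k)\<close> from the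
  first term, and averaging over the fresh value too gives \<open>tail_avg k\<close> from the
  second. The contraction property of \<open>Lp_fibre_integral\<close> finishes the
  estimate.\<close>

lemma tail_avg_increment_le:
  assumes Y: "Y \<in> Lp S q" and q: "1 < q"
  shows "(\<integral>x. \<bar>tail_avg (Suc k) Y x - tail_avg k Y x\<bar> powr q \<partial>S) \<le> influence q k Y powr q"
proof -
  interpret M: prob_space M by (rule prob_space_M)
  interpret MS: pair_prob_space M S ..
  have [measurable]: "Y \<in> borel_measurable S" using Y by (simp add: Lp_def)
  let ?G = "\<lambda>(e, x). Y x - Y (x(k := e))"
  let ?T = "\<lambda>(x, e, y). (e, comb_seq (Suc k) x y)"
  let ?F = "\<lambda>z. ?G (?T z)"
  have G: "?G \<in> Lp (M \<Otimes>\<^sub>M S) q" using Y q by (intro Lp_influence) auto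
  have T: "?T \<in> measurable (S \<Otimes>\<^sub>M (M \<Otimes>\<^sub>M S)) (M \<Otimes>\<^sub>M S)" by (simp add: split_beta')
  have D: "distr (S \<Otimes>\<^sub>M (M \<Otimes>\<^sub>M S)) (M \<Otimes>\<^sub>M S) ?T = M \<Otimes>\<^sub>M S" by (rule distr_split_at)
  have F: "?F \<in> Lp (S \<Otimes>\<^sub>M (M \<Otimes>\<^sub>M S)) q"
    using Lp_distr_iff[OF T Lp_measurable[OF G], of q] G unfolding D by simp
  have "(\<integral>z. \<bar>?G z\<bar> powr q \<partial>(M \<Otimes>\<^sub>M S)) = (\<integral>z. \<bar>?G z\<bar> powr q \<partial>distr (S \<Otimes>\<^sub>M (M \<Otimes>\<^sub>M S)) (M \<Otimes>\<^sub>M S) ?T)"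
    by (simp only: D)
  also have "\<dots> = (\<integral>z. \<bar>?F z\<bar> powr q \<partial>(S \<Otimes>\<^sub>M (M \<Otimes>\<^sub>M S)))"
    using T by (subst integral_distr) auto
  finally have FG: "(\<integral>z. \<bar>?F z\<bar> powr q \<partial>(S \<Otimes>\<^sub>M (M \<Otimes>\<^sub>M S))) = influence q k Y powr q"
    using q by (simp add: influence_def lpnorm_powr)
  \<comment> \<open>Only almost everywhere, since splitting the integral of the difference needs
    both fibres integrable.\<close>
  have "AE x in S. tail_avg (Suc k) Y x - tail_avg k Y x = (\<integral>z. ?F (x, z) \<partial>(M \<Otimes>\<^sub>M S))"
    using Lp_fibre_integral(3)[OF prob_space_S prob_space_S Lp_comb_seq[OF Y, of "Suc k"] q]
      Lp_fibre_integral(3)[OF prob_space_S prob_space_S Lp_comb_seq[OF Y, of k] q] AE_space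
  proof eventually_elim
    case (elim x)
    have [measurable]: "x \<in> space S" by fact
    let ?A = "\<lambda>y. Y (comb_seq (Suc k) x y)" and ?B = "\<lambda>y. Y (comb_seq k x y)"
    have dA: "distr (M \<Otimes>\<^sub>M S) S snd = S"
      by (rule distr_snd_prob[OF prob_space_M P.sigma_finite_measure_axioms])
    have dB: "distr (M \<Otimes>\<^sub>M S) S (\<lambda>(s, \<omega>). case_nat s \<omega>) = S" by (rule PiM_iter)
    have A: "integrable (M \<Otimes>\<^sub>M S) (\<lambda>z. ?A (snd z))" "(\<integral>z. ?A (snd z) \<partial>(M \<Otimes>\<^sub>M S)) = tail_avg (Suc k) Y x"
      using integrable_distr_eq[of snd "M \<Otimes>\<^sub>M S" S ?A] integral_distr[of snd "M \<Otimes>\<^sub>M S" S ?A] elim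
      unfolding dA by (simp_all add: tail_avg_def)
    have B: "integrable (M \<Otimes>\<^sub>M S) (\<lambda>z. ?B (case_nat (fst z) (snd z)))"
      "(\<integral>z. ?B (case_nat (fst z) (snd z)) \<partial>(M \<Otimes>\<^sub>M S)) = tail_avg k Y x"
      using integrable_distr_eq[of "\<lambda>(s, \<omega>). case_nat s \<omega>" "M \<Otimes>\<^sub>M S" S ?B]
        integral_distr[of "\<lambda>(s, \<omega>). case_nat s \<omega>" "M \<Otimes>\<^sub>M S" S ?B] elim
      unfolding dB by (simp_all add: tail_avg_def split_beta')
    have "(\<integral>z. ?F (x, z) \<partial>(M \<Otimes>\<^sub>M S)) = (\<integral>z. ?A (snd z) - ?B (case_nat (fst z) (snd z)) \<partial>(M \<Otimes>\<^sub>M S))"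
      by (simp add: split_beta' comb_seq_Suc_upd)
    also have "\<dots> = tail_avg (Suc k) Y x - tail_avg k Y x"
      using A B by simp
    finally show ?case by simp
  qed
  then have "(\<integral>x. \<bar>tail_avg (Suc k) Y x - tail_avg k Y x\<bar> powr q \<partial>S)
      = (\<integral>x. \<bar>\<integral>z. ?F (x, z) \<partial>(M \<Otimes>\<^sub>M S)\<bar> powr q \<partial>S)"
    using Lp_measurable[OF Lp_fibre_integral(1)[OF prob_space_S MS.prob_space_axioms F q]]
    by (intro integral_cong_AE) auto
  also have "\<dots> \<le> (\<integral>z. \<bar>?F z\<bar> powr q \<partial>(S \<Otimes>\<^sub>M (M \<Otimes>\<^sub>M S)))"
    by (rule Lp_fibre_integral(2)[OF prob_space_S MS.prob_space_axioms F q])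
  finally show ?thesis using FG by simp
qed

end

section \<open>Approximation by finitely many coordinates\<close>

context sequence_space
begin

text \<open>The L1 effect of replacing all coordinates \<ge> k by independent copies. It dominates
  the L1 error of \<open>tail_avg k\<close> and is easy to follow through an induction over sets and
  functions.\<close>

definition tail_gap :: "nat \<Rightarrow> ((nat \<Rightarrow> 'a) \<Rightarrow> real) \<Rightarrow> real" where
  "tail_gap k Y = (\<integral>z. \<bar>Y (fst z) - Y (comb_seq k (fst z) (snd z))\<bar> \<partial>(S \<Otimes>\<^sub>M S))"

lemma tail_gap_nonneg: "0 \<le> tail_gap k Y"
  by (simp add: tail_gap_def)

lemma pair_fst_comb_seq:
  fixes f :: "(nat \<Rightarrow> 'a) \<Rightarrow> real"
  assumes "integrable S f"
  shows "integrable (S \<Otimes>\<^sub>M S) (\<lambda>z. f (fst z))" "(\<integral>z. f (fst z) \<partial>(S \<Otimes>\<^sub>M S)) = (\<integral>x. f x \<partial>S)"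
    and "integrable (S \<Otimes>\<^sub>M S) (\<lambda>z. f (comb_seq k (fst z) (snd z)))"
      "(\<integral>z. f (comb_seq k (fst z) (snd z)) \<partial>(S \<Otimes>\<^sub>M S)) = (\<integral>x. f x \<partial>S)"
proof -
  have [measurable]: "f \<in> borel_measurable S" using assms by auto
  have d1: "distr (S \<Otimes>\<^sub>M S) S fst = S" by (rule P.distr_pair_fst)
  have d2: "distr (S \<Otimes>\<^sub>M S) S (\<lambda>z. comb_seq k (fst z) (snd z)) = S"
    using PiM_comb_seq[of k] by (simp add: split_beta')
  show "integrable (S \<Otimes>\<^sub>M S) (\<lambda>z. f (fst z))" "(\<integral>z. f (fst z) \<partial>(S \<Otimes>\<^sub>M S)) = (\<integral>x. f x \<partial>S)"
    using integrable_distr_eq[of fst "S \<Otimes>\<^sub>M S" S f] integral_distr[of fst "S \<Otimes>\<^sub>M S" S f] assms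
    unfolding d1 by simp_all
  show "integrable (S \<Otimes>\<^sub>M S) (\<lambda>z. f (comb_seq k (fst z) (snd z)))"
      "(\<integral>z. f (comb_seq k (fst z) (snd z)) \<partial>(S \<Otimes>\<^sub>M S)) = (\<integral>x. f x \<partial>S)"
    using integrable_distr_eq[of "\<lambda>z. comb_seq k (fst z) (snd z)" "S \<Otimes>\<^sub>M S" S f]
      integral_distr[of "\<lambda>z. comb_seq k (fst z) (snd z)" "S \<Otimes>\<^sub>M S" S f] assms
    unfolding d2 by simp_all
qed

lemma tail_gap_add:
  assumes "integrable S Y" "integrable S Z"
  shows "tail_gap k (\<lambda>x. Y x + Z x) \<le> tail_gap k Y + tail_gap k Z"
proof -
  note i = pair_fst_comb_seq(1)[OF assms(1)] pair_fst_comb_seq(1)[OF assms(2)]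
    pair_fst_comb_seq(3)[OF assms(1), of k] pair_fst_comb_seq(3)[OF assms(2), of k]
  have "tail_gap k (\<lambda>x. Y x + Z x) \<le> (\<integral>z. \<bar>Y (fst z) - Y (comb_seq k (fst z) (snd z))\<bar>
      + \<bar>Z (fst z) - Z (comb_seq k (fst z) (snd z))\<bar> \<partial>(S \<Otimes>\<^sub>M S))"
    unfolding tail_gap_def using i
    by (intro integral_mono integrable_abs Bochner_Integration.integrable_add Bochner_Integration.integrable_diff)
      (auto simp: abs_if)
  also have "\<dots> = tail_gap k Y + tail_gap k Z"
    unfolding tail_gap_def using i by simp
  finally show ?thesis .
qed

lemma tail_gap_le:
  assumes "integrable S Y"
  shows "tail_gap k Y \<le> 2 * (\<integral>x. \<bar>Y x\<bar> \<partial>S)"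
proof -
  note i = pair_fst_comb_seq[OF assms] pair_fst_comb_seq[OF integrable_abs[OF assms]]
  have "tail_gap k Y \<le> (\<integral>z. \<bar>Y (fst z)\<bar> + \<bar>Y (comb_seq k (fst z) (snd z))\<bar> \<partial>(S \<Otimes>\<^sub>M S))"
    unfolding tail_gap_def using i(1,3)
    by (intro integral_mono integrable_abs Bochner_Integration.integrable_add Bochner_Integration.integrable_diff) auto
  also have "\<dots> = 2 * (\<integral>x. \<bar>Y x\<bar> \<partial>S)"
    using i(5-) by simp
  finally show ?thesis .
qed

text \<open>By \<open>tail_gap_le\<close> an L1-small change of the function changes the gap little,
  uniformly in k, and dominated convergence makes \<open>s i\<close> L1-close to \<open>f\<close>.
  The hypotheses have the form supplied by \<open>integrable_induct\<close>.\<close>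

lemma tail_gap_tendsto_lim:
  assumes s: "\<And>i. integrable S (s i)" "\<And>i. (\<lambda>k. tail_gap k (s i)) \<longlonglongrightarrow> 0"
    and lim: "\<And>x. x \<in> space S \<Longrightarrow> (\<lambda>i. s i x) \<longlonglongrightarrow> f x"
    and bound: "\<And>i x. x \<in> space S \<Longrightarrow> norm (s i x) \<le> 2 * norm (f x)"
    and f: "integrable S f"
  shows "(\<lambda>k. tail_gap k f) \<longlonglongrightarrow> 0"
proof (rule LIMSEQ_I)
  fix e :: real assume "0 < e"
  have [measurable]: "f \<in> borel_measurable S" "s i \<in> borel_measurable S" for i
    using f s(1) by auto
  have "(\<lambda>i. \<integral>x. \<bar>f x - s i x\<bar> \<partial>S) \<longlonglongrightarrow> (\<integral>x. 0 \<partial>S)"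
  proof (rule integral_dominated_convergence)
    show "integrable S (\<lambda>x. 3 * \<bar>f x\<bar>)" using f by simp
    show "AE x in S. (\<lambda>i. \<bar>f x - s i x\<bar>) \<longlonglongrightarrow> 0"
      using lim by (intro AE_I2 tendsto_rabs_zero) (auto intro!: tendsto_eq_intros)
    show "AE x in S. norm \<bar>f x - s i x\<bar> \<le> 3 * \<bar>f x\<bar>" for i
    proof (rule AE_I2)
      fix x assume "x \<in> space S"
      then show "norm \<bar>f x - s i x\<bar> \<le> 3 * \<bar>f x\<bar>" using bound[of x i] by simp
    qed
  qed measurable
  \<comment> \<open>A quarter of e, because \<open>tail_gap_le\<close> doubles the L1 norm.\<close>
  then obtain i where i: "(\<integral>x. \<bar>f x - s i x\<bar> \<partial>S) < e / 4"
    using LIMSEQ_D[of "\<lambda>i. \<integral>x. \<bar>f x - s i x\<bar> \<partial>S" 0 "e / 4"] \<open>0 < e\<close> by fastforce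
  obtain K where K: "\<And>k. K \<le> k \<Longrightarrow> tail_gap k (s i) < e / 2"
    using LIMSEQ_D[OF s(2)[of i], of "e / 2"] \<open>0 < e\<close> tail_gap_nonneg by fastforce
  have "tail_gap k f < e" if "K \<le> k" for k
  proof -
    have fi: "integrable S (\<lambda>x. f x - s i x)" using f s(1) by simp
    have "tail_gap k f = tail_gap k (\<lambda>x. s i x + (f x - s i x))" by simp
    also have "\<dots> \<le> tail_gap k (s i) + tail_gap k (\<lambda>x. f x - s i x)"
      by (rule tail_gap_add[OF s(1) fi])
    also have "\<dots> \<le> tail_gap k (s i) + 2 * (\<integral>x. \<bar>f x - s i x\<bar> \<partial>S)"
      using tail_gap_le[OF fi] by simp
    finally show ?thesis using K[OF that] i by simp
  qed
  then show "\<exists>K. \<forall>k\<ge>K. norm (tail_gap k f - 0) < e"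
    using tail_gap_nonneg by (intro exI[of _ K]) auto
qed

lemma tail_gap_tendsto_add:
  assumes "integrable S Y" "integrable S Z"
    and "(\<lambda>k. tail_gap k Y) \<longlonglongrightarrow> 0" "(\<lambda>k. tail_gap k Z) \<longlonglongrightarrow> 0"
  shows "(\<lambda>k. tail_gap k (\<lambda>x. Y x + Z x)) \<longlonglongrightarrow> 0"
proof (rule tendsto_sandwich[where f = "\<lambda>_. 0"])
  show "(\<lambda>k. tail_gap k Y + tail_gap k Z) \<longlonglongrightarrow> 0"
    using tendsto_add[OF assms(3,4)] by simp
qed (use tail_gap_nonneg tail_gap_add[OF assms(1,2)] in auto)

lemma comb_seq_in_space:
  "x \<in> space S \<Longrightarrow> y \<in> space S \<Longrightarrow> comb_seq k x y \<in> space S"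
  by (auto simp: space_PiM PiE_iff comb_seq_def)

text \<open>Dynkin induction. For a cylinder over finitely many coordinates the gap is exactly 0
  once k lies beyond all of them; a complement has the same gap; a countable disjoint union is the
  dominated limit of its finite parts.\<close>

lemma tail_gap_indicator_tendsto:
  assumes "A \<in> sets S"
  shows "(\<lambda>k. tail_gap k (indicator A)) \<longlonglongrightarrow> 0"
proof -
  let ?\<Omega> = "\<Pi>\<^sub>E i\<in>(UNIV::nat set). space M"
  have \<Omega>: "space S = ?\<Omega>" by (simp add: space_PiM)
  have "A \<in> sigma_sets ?\<Omega> (prod_algebra UNIV (\<lambda>i. M))"
    using assms by (simp add: sets_PiM)
  with Int_stable_prod_algebra prod_algebra_sets_into_space show ?thesis
  proof (induction rule: sigma_sets_induct_disjoint)
    case (basic A)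
    then obtain J E where A: "A = prod_emb UNIV (\<lambda>i. M) J (\<Pi>\<^sub>E j\<in>J. E j)" and J: "finite J"
      by (rule prod_algebraE)
    obtain n where n: "\<And>j. j \<in> J \<Longrightarrow> j < n"
      using J finite_nat_set_iff_bounded[of J] by auto
    have "tail_gap k (indicator A) = 0" if "n \<le> k" for k
    proof -
      have "indicator A (comb_seq k x y) = (indicator A x :: real)" if xy: "x \<in> space S" "y \<in> space S" for x y
      proof -
        have "x \<in> A \<longleftrightarrow> comb_seq k x y \<in> A"
          using xy comb_seq_in_space[OF xy, of k] n \<open>n \<le> k\<close> less_le_trans
          unfolding A prod_emb_iff \<Omega>
          by (fastforce simp: restrict_PiE_iff comb_seq_def PiE_iff)
        then show ?thesis by (simp add: indicator_def)
      qed
      then have "tail_gap k (indicator A) = (\<integral>z. 0 \<partial>(S \<Otimes>\<^sub>M S))"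
        unfolding tail_gap_def by (intro Bochner_Integration.integral_cong) (auto simp: space_pair_measure)
      then show ?thesis by simp
    qed
    then show ?case by (intro tendsto_eventually) (auto simp: eventually_sequentially)
  next
    case empty
    then show ?case by (simp add: tail_gap_def)
  next
    case (compl A)
    have "tail_gap k (indicator (?\<Omega> - A)) = tail_gap k (indicator A)" for k
    proof -
      have "\<bar>indicator (?\<Omega> - A) x - indicator (?\<Omega> - A) y\<bar> = \<bar>indicator A x - indicator A y :: real\<bar>"
        if "x \<in> space S" "y \<in> space S" for x y
        using that unfolding \<Omega> by (auto simp: indicator_def)
      then show ?thesis
        unfolding tail_gap_def
        by (intro Bochner_Integration.integral_cong) (auto simp: space_pair_measure comb_seq_in_space)
    qed
    then show ?case using compl by simp
  next
    case (union A)
    have [measurable]: "A i \<in> sets S" for i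
      using union(2) by (auto simp: sets_PiM)
    have part: "(\<lambda>k. tail_gap k (indicator (\<Union>i<n. A i))) \<longlonglongrightarrow> 0" for n
    proof (induction n)
      case 0
      then show ?case by (simp add: tail_gap_def)
    next
      case (Suc n)
      have "A n \<inter> A i = {}" if "i < n" for i
        using disjoint_family_onD[OF union(1), of n i] that by auto
      then have "A n \<inter> (\<Union>i<n. A i) = {}" by auto
      then have "indicator (\<Union>i<Suc n. A i) = (\<lambda>x. indicator (\<Union>i<n. A i) x + indicator (A n) x :: real)"
        by (auto simp: indicator_def fun_eq_iff lessThan_Suc)
      moreover have "(\<lambda>k. tail_gap k (\<lambda>x. indicator (\<Union>i<n. A i) x + indicator (A n) x)) \<longlonglongrightarrow> 0"
        using Suc union(3) by (intro tail_gap_tendsto_add) (auto simp: integrable_real_indicator less_top[symmetric])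
      ultimately show ?case by simp
    qed
    show ?case
    proof (rule tail_gap_tendsto_lim)
      show "(\<lambda>i. indicator (\<Union>j<i. A j) x :: real) \<longlonglongrightarrow> indicator (\<Union>i. A i) x" for x
        by (rule LIMSEQ_indicator_UN)
      show "norm (indicator (\<Union>j<i. A j) x :: real) \<le> 2 * norm (indicator (\<Union>i. A i) x :: real)" for i x
        by (auto simp: indicator_def)
    qed (use part in \<open>auto simp: integrable_real_indicator less_top[symmetric]\<close>)
  qed
qed

lemma tail_gap_tendsto:
  assumes "integrable S Y"
  shows "(\<lambda>k. tail_gap k Y) \<longlonglongrightarrow> 0"
  using assms
proof (induction rule: integrable_induct)
  case (base A c)
  have "tail_gap k (\<lambda>x. indicator A x *\<^sub>R c) = tail_gap k (indicator A) * \<bar>c\<bar>" for k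
    unfolding tail_gap_def by (simp add: abs_mult flip: left_diff_distrib)
  then show ?case
    using tendsto_mult_right[OF tail_gap_indicator_tendsto[OF base(1)], of "\<bar>c\<bar>"] by simp
next
  case (add f g)
  then show ?case by (intro tail_gap_tendsto_add)
next
  case (lim f s)
  show ?case by (rule tail_gap_tendsto_lim) (fact lim)+
qed

text \<open>The absolute value is moved inside the average over the tail. With
  \<open>tail_gap_tendsto\<close> this yields L1 convergence of \<open>tail_avg k Y\<close> to
  \<open>Y\<close>.\<close>

lemma tail_avg_diff_le_tail_gap:
  assumes Y: "Y \<in> Lp S q" "1 < q"
  shows "(\<integral>x. \<bar>tail_avg k Y x - Y x\<bar> \<partial>S) \<le> tail_gap k Y"
proof -
  interpret SS: pair_prob_space S S ..
  have [measurable]: "Y \<in> borel_measurable S" using Y by (simp add: Lp_def)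
  have Yi: "integrable S Y" using P.Lp_integrable[OF Y(1)] Y(2) by simp
  have Ai: "integrable S (tail_avg k Y)"
    using P.Lp_integrable[OF Lp_tail_avg[OF Y]] Y(2) by simp
  let ?F = "\<lambda>z. \<bar>Y (fst z) - Y (comb_seq k (fst z) (snd z))\<bar>"
  have F: "integrable (S \<Otimes>\<^sub>M S) ?F"
    using pair_fst_comb_seq[OF Yi] by auto
  have "AE x in S. \<bar>tail_avg k Y x - Y x\<bar> \<le> (\<integral>y. ?F (x, y) \<partial>S)"
    using Lp_fibre_integral(3)[OF prob_space_S prob_space_S Lp_comb_seq[OF Y(1), of k] Y(2)]
  proof eventually_elim
    case (elim x)
    have "\<bar>tail_avg k Y x - Y x\<bar> = \<bar>\<integral>y. Y (comb_seq k x y) - Y x \<partial>S\<bar>"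
      using elim by (simp add: tail_avg_def P.prob_space)
    also have "\<dots> \<le> (\<integral>y. \<bar>Y (comb_seq k x y) - Y x\<bar> \<partial>S)"
      by (rule integral_abs_bound)
    finally show ?case by (simp add: abs_minus_commute)
  qed
  then have "(\<integral>x. \<bar>tail_avg k Y x - Y x\<bar> \<partial>S) \<le> (\<integral>x. \<integral>y. ?F (x, y) \<partial>S \<partial>S)"
    using Ai Yi SS.integrable_fst'[OF F] by (intro integral_mono_AE) auto
  also have "\<dots> = tail_gap k Y"
    using SS.integral_fst'[OF F] by (simp add: tail_gap_def)
  finally show ?thesis .
qed

text \<open>L1 convergence supplies a subsequence converging almost everywhere, and Fatou's lemma
  carries the uniform moment bound over to the limit.\<close>

lemma integral_powr_le_of_tail_avg:
  assumes Y: "Y \<in> Lp S q" "1 < q" and B: "0 \<le> B"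
    and le: "\<And>n. (\<integral>x. \<bar>tail_avg n Y x - c\<bar> powr q \<partial>S) \<le> B"
  shows "(\<integral>x. \<bar>Y x - c\<bar> powr q \<partial>S) \<le> B"
proof -
  have [measurable]: "Y \<in> borel_measurable S" using Y by (simp add: Lp_def)
  have Yi: "integrable S Y" using P.Lp_integrable[OF Y(1)] Y(2) by simp
  have Ai: "integrable S (tail_avg k Y)" for k
    using P.Lp_integrable[OF Lp_tail_avg[OF Y]] Y(2) by simp
  have lim: "(\<lambda>n. \<integral>x. norm (tail_avg n Y x - Y x) \<partial>S) \<longlonglongrightarrow> 0"
    by (rule tendsto_sandwich[OF _ _ tendsto_const tail_gap_tendsto[OF Yi]])
      (use tail_avg_diff_le_tail_gap[OF Y] in auto)
  obtain r where "strict_mono r" and r: "AE x in S. (\<lambda>n. tail_avg (r n) Y x - Y x) \<longlonglongrightarrow> 0"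
    using tendsto_L1_AE_subseq[OF _ lim] Ai Yi by auto
  let ?u = "\<lambda>n x. ennreal (\<bar>tail_avg (r n) Y x - c\<bar> powr q)"
  have L: "(\<lambda>x. Y x - c) \<in> Lp S q" "(\<lambda>x. tail_avg n Y x - c) \<in> Lp S q" for n
    using Lp_diff[OF Y(1) P.Lp_const] Lp_diff[OF Lp_tail_avg[OF Y] P.Lp_const] Y(2) by auto
  have "(\<integral>\<^sup>+x. ennreal (\<bar>Y x - c\<bar> powr q) \<partial>S) = (\<integral>\<^sup>+x. liminf (\<lambda>n. ?u n x) \<partial>S)"
  proof (rule nn_integral_cong_AE)
    show "AE x in S. ennreal (\<bar>Y x - c\<bar> powr q) = liminf (\<lambda>n. ?u n x)"
      using r
    proof eventually_elim
      case (elim x)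
      have "(\<lambda>n. tail_avg (r n) Y x) \<longlonglongrightarrow> Y x"
        using tendsto_add[OF elim tendsto_const[of "Y x"]] by simp
      then have "(\<lambda>n. \<bar>tail_avg (r n) Y x - c\<bar> powr q) \<longlonglongrightarrow> \<bar>Y x - c\<bar> powr q"
        using Y(2) by (intro tendsto_powr' tendsto_intros) auto
      then have "(\<lambda>n. ?u n x) \<longlonglongrightarrow> ennreal (\<bar>Y x - c\<bar> powr q)"
        by (intro tendsto_ennrealI)
      then show ?case by (intro lim_imp_Liminf[symmetric]) auto
    qed
  qed
  also have "\<dots> \<le> liminf (\<lambda>n. \<integral>\<^sup>+x. ?u n x \<partial>S)"
    by (rule nn_integral_liminf) measurable
  also have "\<dots> \<le> limsup (\<lambda>n. \<integral>\<^sup>+x. ?u n x \<partial>S)"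
    by (rule Liminf_le_Limsup) simp
  also have "\<dots> \<le> ennreal B"
  proof (rule Limsup_bounded, rule always_eventually, rule allI)
    fix n
    have "(\<integral>\<^sup>+x. ?u n x \<partial>S) = ennreal (\<integral>x. \<bar>tail_avg (r n) Y x - c\<bar> powr q \<partial>S)"
      using L by (intro nn_integral_eq_integral) (auto simp: Lp_def)
    then show "(\<integral>\<^sup>+x. ?u n x \<partial>S) \<le> ennreal B" using le[of "r n"] by (simp add: ennreal_leI)
  qed
  also have "(\<integral>\<^sup>+x. ennreal (\<bar>Y x - c\<bar> powr q) \<partial>S) = ennreal (\<integral>x. \<bar>Y x - c\<bar> powr q \<partial>S)"
    using L by (intro nn_integral_eq_integral) (auto simp: Lp_def)
  finally show ?thesis using B by simp
qed

text \<open>These are the martingale hypotheses of \<open>von_Bahr_Esseen\<close> and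
  \<open>Rio_inequality\<close>, where \<open>tail_avg 0 Y\<close> is the constant mean.\<close>

lemma tail_avg_martingale:
  assumes Y: "Y \<in> Lp S q" "1 < q"
  defines "c \<equiv> \<integral>x. Y x \<partial>S"
  shows "(\<lambda>x. tail_avg n Y x - c) \<in> Lp S q"
    and "tail_avg 0 Y x - c = 0"
    and "(\<integral>x. sgn_powr (q - 1) (tail_avg n Y x - c) * ((tail_avg (Suc n) Y x - c) - (tail_avg n Y x - c)) \<partial>S) = 0"
proof -
  have [measurable]: "Y \<in> borel_measurable S" using Y by (simp add: Lp_def)
  have A: "tail_avg n Y \<in> Lp S q" for n by (rule Lp_tail_avg[OF Y])
  show L: "(\<lambda>x. tail_avg n Y x - c) \<in> Lp S q" for n
    using Lp_diff[OF A P.Lp_const] Y(2) by simp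
  show "tail_avg 0 Y x - c = 0"
    by (simp add: tail_avg_def comb_seq_0 c_def)
  have int: "integrable S (\<lambda>x. sgn_powr (q - 1) (tail_avg n Y x - c) * g x)" if "g \<in> Lp S q" for g
    by (rule sgn_powr_mult_integrable[OF L that Y(2)])
  \<comment> \<open>Used for m = n and m = Suc n: both integrals equal the one against
    \<open>Y\<close>, so their difference is 0.\<close>
  have eq: "(\<integral>x. sgn_powr (q - 1) (tail_avg n Y x - c) * tail_avg m Y x \<partial>S)
      = (\<integral>x. sgn_powr (q - 1) (tail_avg n Y x - c) * Y x \<partial>S)" if "n \<le> m" for m
    using int[OF Y(1)] that
    by (intro integral_tail_avg_mult[where h = "\<lambda>t. sgn_powr (q - 1) (t - c)"]) auto
  have "(\<integral>x. sgn_powr (q - 1) (tail_avg n Y x - c) * tail_avg (Suc n) Y x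
        - sgn_powr (q - 1) (tail_avg n Y x - c) * tail_avg n Y x \<partial>S) = 0"
    using eq[of n] eq[of "Suc n"] int[OF A, of "Suc n"] int[OF A, of n] by simp
  then show "(\<integral>x. sgn_powr (q - 1) (tail_avg n Y x - c) * ((tail_avg (Suc n) Y x - c) - (tail_avg n Y x - c)) \<partial>S) = 0"
    by (simp add: right_diff_distrib)
qed

section \<open>Efron-Stein bounds from the martingale of tail averages\<close>

theorem integral_powr_centered_le_influence:
  assumes Y: "Y \<in> Lp S q" and q: "1 < q" "q \<le> 2"
    and B: "\<And>n. (\<Sum>k<n. influence q k Y powr q) \<le> B"
  shows "(\<integral>x. \<bar>Y x - (\<integral>x. Y x \<partial>S)\<bar> powr q \<partial>S) \<le> 2 * q * B"
proof (rule integral_powr_le_of_tail_avg[OF Y q(1)])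
  show "0 \<le> 2 * q * B" using B[of 0] q by simp
  fix n
  let ?D = "\<lambda>n x. tail_avg n Y x - (\<integral>x. Y x \<partial>S)"
  have "(\<integral>x. \<bar>?D n x\<bar> powr q \<partial>S) \<le> 2 * q * (\<Sum>k<n. \<integral>x. \<bar>?D (Suc k) x - ?D k x\<bar> powr q \<partial>S)"
    using tail_avg_martingale[OF Y q(1)] by (intro von_Bahr_Esseen q) auto
  also have "\<dots> \<le> 2 * q * (\<Sum>k<n. influence q k Y powr q)"
    using tail_avg_increment_le[OF Y q(1)] q by (intro mult_left_mono sum_mono) auto
  also have "\<dots> \<le> 2 * q * B"
    using B q by (intro mult_left_mono) auto
  finally show "(\<integral>x. \<bar>?D n x\<bar> powr q \<partial>S) \<le> 2 * q * B" .
qed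

text \<open>\<open>Rio_inequality\<close> bounds every centred tail average by the same radius, and
  \<open>integral_powr_le_of_tail_avg\<close> passes to \<open>Y\<close>.\<close>

theorem lpnorm_centered_le_influence:
  assumes Y: "Y \<in> Lp S a" and a: "2 < a"
    and B: "\<And>n. (\<Sum>k<n. (influence a k Y)\<^sup>2) \<le> B"
  shows "lpnorm S a (\<lambda>x. Y x - (\<integral>x. Y x \<partial>S)) \<le> sqrt (4 * a * a * 2 powr a * B)"
proof -
  have a1: "1 < a" using a by simp
  have B0: "0 \<le> B" using B[of 0] by simp
  let ?D = "\<lambda>n x. tail_avg n Y x - (\<integral>x. Y x \<partial>S)"
  let ?R = "sqrt (4 * a * a * 2 powr a * B)"
  have R: "0 \<le> ?R" using a B0 by simp
  have "(\<integral>x. \<bar>?D n x\<bar> powr a \<partial>S) \<le> ?R powr a" for n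
  proof -
    have "lpnorm S a (\<lambda>x. ?D (Suc k) x - ?D k x) \<le> influence a k Y" for k
      using tail_avg_increment_le[OF Y a1, of k] a
      by (intro lpnorm_le) (auto simp: influence_def)
    then have inc: "(lpnorm S a (\<lambda>x. ?D (Suc k) x - ?D k x))\<^sup>2 \<le> (influence a k Y)\<^sup>2" for k
      by (intro power_mono) auto
    have "(lpnorm S a (?D n))\<^sup>2 \<le> 4 * a * a * 2 powr a * (\<Sum>k<n. (lpnorm S a (\<lambda>x. ?D (Suc k) x - ?D k x))\<^sup>2)"
      using tail_avg_martingale[OF Y a1] by (intro Rio_inequality a) auto
    also have "\<dots> \<le> 4 * a * a * 2 powr a * B"
      using a by (intro mult_left_mono order_trans[OF sum_mono[OF inc] B]) auto
    finally have "lpnorm S a (?D n) \<le> ?R" by (rule real_le_rsqrt)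
    then have "lpnorm S a (?D n) powr a \<le> ?R powr a"
      using a by (intro powr_mono2) auto
    then show ?thesis using a by (simp add: lpnorm_powr)
  qed
  then have "(\<integral>x. \<bar>Y x - (\<integral>x. Y x \<partial>S)\<bar> powr a \<partial>S) \<le> ?R powr a"
    by (intro integral_powr_le_of_tail_avg[OF Y a1]) auto
  then show ?thesis using a R by (intro lpnorm_le) auto
qed

end

section \<open>Sums over windows of a stationary process\<close>

context sequence_space
begin

text \<open>Coordinates run backwards in time, so dropping the first j of them moves j steps into
  the past.\<close>

definition lag :: "nat \<Rightarrow> ((nat \<Rightarrow> 'a) \<Rightarrow> real) \<Rightarrow> (nat \<Rightarrow> 'a) \<Rightarrow> real" where
  "lag j Y x = Y (\<lambda>k. x (j + k))"

lemma measurable_shift [measurable]: "(\<lambda>x k. x (j + k)) \<in> measurable S S"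
  by (rule measurable_PiM_single') (auto simp: space_PiM)

lemma measurable_lag [measurable]:
  assumes [measurable]: "Y \<in> borel_measurable S"
  shows "lag j Y \<in> borel_measurable S"
  unfolding lag_def[abs_def] by measurable

lemma Lp_lag: "Y \<in> Lp S q \<Longrightarrow> lag j Y \<in> Lp S q"
  using Lp_distr_iff[of "\<lambda>x k. x (j + k)" S S Y q] distr_shift[of j]
  by (simp add: Lp_measurable lag_def[abs_def])

lemma integral_lag:
  assumes "Y \<in> borel_measurable S"
  shows "(\<integral>x. lag j Y x \<partial>S) = (\<integral>x. Y x \<partial>S)"
  using integral_distr[of "\<lambda>x k. x (j + k)" S S Y] assms distr_shift[of j]
  by (simp add: lag_def)

lemma influence_nonneg [simp]: "0 \<le> influence q k Y"
  by (simp add: influence_def)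

text \<open>Coordinate k of the full sequence is coordinate k - j of the shifted one. For k < j it
  is an innovation later than the lagged variable, which by causality does not see it.\<close>

lemma influence_lag:
  assumes [measurable]: "Y \<in> borel_measurable S"
  shows "influence q k (lag j Y) = (if j \<le> k then influence q (k - j) Y else 0)"
proof (cases "j \<le> k")
  case True
  let ?G = "\<lambda>(e, x). Y x - Y (x(k - j := e))"
  have eq: "(\<lambda>i. (x(k := e)) (j + i)) = (\<lambda>i. x (j + i))(k - j := e)" for x :: "nat \<Rightarrow> 'a" and e
    using True by (auto simp: fun_eq_iff)
  have "M \<Otimes>\<^sub>M S = distr M M (\<lambda>e. e) \<Otimes>\<^sub>M distr S S (\<lambda>x k. x (j + k))"
    by (simp add: distr_shift)
  also have "\<dots> = distr (M \<Otimes>\<^sub>M S) (M \<Otimes>\<^sub>M S) (\<lambda>(e, x). (e, \<lambda>k. x (j + k)))"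
    using distr_shift[of j] P.sigma_finite_measure_axioms by (intro pair_measure_distr) auto
  finally have D: "distr (M \<Otimes>\<^sub>M S) (M \<Otimes>\<^sub>M S) (\<lambda>(e, x). (e, \<lambda>k. x (j + k))) = M \<Otimes>\<^sub>M S" ..
  have T: "(\<lambda>(e, x). (e, \<lambda>k. x (j + k))) \<in> measurable (M \<Otimes>\<^sub>M S) (M \<Otimes>\<^sub>M S)"
    unfolding split_beta'
    by (intro measurable_Pair measurable_compose[OF measurable_snd measurable_shift] measurable_fst)
  have G: "?G \<in> borel_measurable (M \<Otimes>\<^sub>M S)" by measurable
  have "influence q k (lag j Y) = lpnorm (M \<Otimes>\<^sub>M S) q (\<lambda>z. ?G ((\<lambda>(e, x). (e, \<lambda>k. x (j + k))) z))"
    by (simp add: influence_def lag_def eq split_beta' del: fun_upd_apply)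
  also have "\<dots> = influence q (k - j) Y"
    using lpnorm_distr[OF T G, of q] unfolding D influence_def by simp
  finally show ?thesis using True by simp
next
  case False
  then have "(\<lambda>i. (x(k := e)) (j + i)) = (\<lambda>i. x (j + i))" for x :: "nat \<Rightarrow> 'a" and e
    by (auto simp: fun_eq_iff)
  then show ?thesis
    using False by (simp add: influence_def lag_def lpnorm_def split_beta' del: fun_upd_apply)
qed

lemma influence_sum_le:
  assumes "\<And>i. i \<in> I \<Longrightarrow> Y i \<in> Lp S q" "1 < q"
  shows "influence q k (\<lambda>x. \<Sum>i\<in>I. Y i x) \<le> (\<Sum>i\<in>I. influence q k (Y i))"
proof -
  have "influence q k (\<lambda>x. \<Sum>i\<in>I. Y i x)
      = lpnorm (M \<Otimes>\<^sub>M S) q (\<lambda>z. \<Sum>i\<in>I. (\<lambda>(e, x). Y i x - Y i (x(k := e))) z)"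
    by (simp add: influence_def sum_subtractf split_beta')
  also have "\<dots> \<le> (\<Sum>i\<in>I. influence q k (Y i))"
    unfolding influence_def using assms by (intro lpnorm_sum_le Lp_influence) auto
  finally show ?thesis .
qed

text \<open>A difference of squares factors as (u - v)(u + v). Cauchy-Schwarz separates the factors,
  and the sum has norm at most twice that of \<open>Y\<close> because resampling preserves the
  law.\<close>

lemma influence_square_le:
  assumes Y: "Y \<in> Lp S (2 * q)" and q: "1 < q"
  shows "influence q k (\<lambda>x. (Y x)\<^sup>2) \<le> 2 * lpnorm S (2 * q) Y * influence (2 * q) k Y"
proof -
  have [measurable]: "Y \<in> borel_measurable S" using Y by (simp add: Lp_def)
  let ?A = "\<lambda>z. Y (snd z)" and ?B = "\<lambda>z. Y ((snd z)(k := fst z))"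
  have dA: "distr (M \<Otimes>\<^sub>M S) S snd = S"
    by (rule distr_snd_prob[OF prob_space_M P.sigma_finite_measure_axioms])
  have dB: "distr (M \<Otimes>\<^sub>M S) S (\<lambda>z. (snd z)(k := fst z)) = S"
    using distr_upd[of k] by (simp add: split_beta')
  have A: "?A \<in> Lp (M \<Otimes>\<^sub>M S) (2 * q)" "lpnorm (M \<Otimes>\<^sub>M S) (2 * q) ?A = lpnorm S (2 * q) Y"
    using Y Lp_distr_iff[of snd "M \<Otimes>\<^sub>M S" S Y "2 * q"] lpnorm_distr[of snd "M \<Otimes>\<^sub>M S" S Y "2 * q"]
    unfolding dA by auto
  have B: "?B \<in> Lp (M \<Otimes>\<^sub>M S) (2 * q)" "lpnorm (M \<Otimes>\<^sub>M S) (2 * q) ?B = lpnorm S (2 * q) Y"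
    using Y Lp_distr_iff[of "\<lambda>z. (snd z)(k := fst z)" "M \<Otimes>\<^sub>M S" S Y "2 * q"]
      lpnorm_distr[of "\<lambda>z. (snd z)(k := fst z)" "M \<Otimes>\<^sub>M S" S Y "2 * q"]
    unfolding dB by auto
  have "influence q k (\<lambda>x. (Y x)\<^sup>2) = lpnorm (M \<Otimes>\<^sub>M S) q (\<lambda>z. (?A z - ?B z) * (?A z + ?B z))"
    by (simp add: influence_def split_beta' power2_eq_square algebra_simps)
  also have "\<dots> \<le> lpnorm (M \<Otimes>\<^sub>M S) (2 * q) (\<lambda>z. ?A z - ?B z) * lpnorm (M \<Otimes>\<^sub>M S) (2 * q) (\<lambda>z. ?A z + ?B z)"
    using A B q by (intro lpnorm_mult_le Lp_diff Lp_add) auto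
  also have "\<dots> \<le> lpnorm (M \<Otimes>\<^sub>M S) (2 * q) (\<lambda>z. ?A z - ?B z) * (2 * lpnorm S (2 * q) Y)"
    using lpnorm_add_le[OF A(1) B(1)] A(2) B(2) q by (intro mult_left_mono) auto
  also have "lpnorm (M \<Otimes>\<^sub>M S) (2 * q) (\<lambda>z. ?A z - ?B z) = influence (2 * q) k Y"
    by (simp add: influence_def split_beta')
  finally show ?thesis by (simp add: mult_ac)
qed

text \<open>\<open>b\<close> is the convolution of \<open>d\<close> with the indicator of
  \<open>J\<close>. The supremum is bounded by the total mass of \<open>d\<close>, the sum by the
  product of the two masses.\<close>

lemma convolution_bounds:
  fixes d :: "nat \<Rightarrow> real"
  assumes d: "\<And>k. 0 \<le> d k" "\<And>n. (\<Sum>k<n. d k) \<le> \<Delta>" and J: "finite J"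
  defines "b \<equiv> \<lambda>k. \<Sum>j\<in>J. if j \<le> k then d (k - j) else 0"
  shows "0 \<le> b k" "b k \<le> \<Delta>" "(\<Sum>k<n. b k) \<le> real (card J) * \<Delta>"
proof -
  show "0 \<le> b k" by (auto simp: b_def d intro: sum_nonneg)
  have "b k = (\<Sum>j\<in>J \<inter> {..k}. d (k - j))"
    unfolding b_def using J by (simp add: sum.inter_restrict)
  also have "\<dots> \<le> (\<Sum>j\<in>{..k}. d (k - j))"
    using d by (intro sum_mono2) auto
  also have "\<dots> = (\<Sum>i\<in>{..k}. d i)"
    by (rule sum.reindex_bij_witness[of _ "\<lambda>i. k - i" "\<lambda>i. k - i"]) auto
  also have "\<dots> \<le> \<Delta>" using d(2)[of "Suc k"] by (simp add: lessThan_Suc_atMost)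
  finally show "b k \<le> \<Delta>" .
  have "(\<Sum>k<n. b k) = (\<Sum>j\<in>J. \<Sum>k<n. if j \<le> k then d (k - j) else 0)"
    unfolding b_def by (rule sum.swap)
  also have "\<dots> \<le> (\<Sum>j\<in>J. \<Delta>)"
  proof (rule sum_mono)
    fix j
    have "(\<Sum>k<n. if j \<le> k then d (k - j) else 0) = (\<Sum>k\<in>{..<n} \<inter> {j..}. d (k - j))"
      by (simp add: sum.inter_restrict)
    also have "\<dots> = (\<Sum>i<n - j. d i)"
      by (rule sum.reindex_bij_witness[of _ "\<lambda>i. i + j" "\<lambda>k. k - j"]) auto
    also have "\<dots> \<le> \<Delta>" by (rule d)
    finally show "(\<Sum>k<n. if j \<le> k then d (k - j) else 0) \<le> \<Delta>" .
  qed
  finally show "(\<Sum>k<n. b k) \<le> real (card J) * \<Delta>" by simp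
qed

text \<open>The squared influences sum to at most supremum times sum of the convolution, that is
  \<Delta> times card J times \<Delta>. The Efron-Stein bound for squares then gives the square root
  of the window size; the mean is 0, so no centring remains.\<close>

lemma lpnorm_lag_sum_le:
  assumes g: "g \<in> Lp S a" "2 < a" "(\<integral>x. g x \<partial>S) = 0"
    and \<Delta>: "\<And>n. (\<Sum>k<n. influence a k g) \<le> \<Delta>" and J: "finite J"
  shows "(\<lambda>x. \<Sum>j\<in>J. lag j g x) \<in> Lp S a"
    and "influence a k (\<lambda>x. \<Sum>j\<in>J. lag j g x) \<le> (\<Sum>j\<in>J. if j \<le> k then influence a (k - j) g else 0)"
    and "lpnorm S a (\<lambda>x. \<Sum>j\<in>J. lag j g x) \<le> sqrt (4 * a * a * 2 powr a) * \<Delta> * sqrt (real (card J))"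
proof -
  have [measurable]: "g \<in> borel_measurable S" using g by (simp add: Lp_def)
  let ?Y = "\<lambda>x. \<Sum>j\<in>J. lag j g x"
  let ?b = "\<lambda>k. \<Sum>j\<in>J. if j \<le> k then influence a (k - j) g else 0"
  note b = convolution_bounds[OF influence_nonneg \<Delta> J]
  have \<Delta>0: "0 \<le> \<Delta>" using \<Delta>[of 0] by simp
  show Y: "?Y \<in> Lp S a" using g by (intro Lp_sum Lp_lag) auto
  show inf: "influence a k ?Y \<le> ?b k" for k
    using influence_sum_le[of J "\<lambda>j. lag j g" a k] g by (simp add: Lp_lag influence_lag)
  have Y0: "(\<integral>x. ?Y x \<partial>S) = 0"
    using P.Lp_integrable[OF Lp_lag[OF g(1)]] g by (subst Bochner_Integration.integral_sum) (auto simp: integral_lag)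
  have "(\<Sum>k<n. (influence a k ?Y)\<^sup>2) \<le> real (card J) * \<Delta>\<^sup>2" for n
  proof -
    have "(\<Sum>k<n. (influence a k ?Y)\<^sup>2) \<le> (\<Sum>k<n. \<Delta> * ?b k)"
    proof (rule sum_mono)
      fix k
      have "(influence a k ?Y)\<^sup>2 \<le> (?b k)\<^sup>2"
        using inf by (intro power_mono) auto
      also have "\<dots> \<le> \<Delta> * ?b k"
        unfolding power2_eq_square using b by (intro mult_right_mono) auto
      finally show "(influence a k ?Y)\<^sup>2 \<le> \<Delta> * ?b k" .
    qed
    also have "\<dots> = \<Delta> * (\<Sum>k<n. ?b k)" by (simp add: sum_distrib_left)
    also have "\<dots> \<le> \<Delta> * (real (card J) * \<Delta>)"
      using b \<Delta>0 by (intro mult_left_mono) auto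
    finally show ?thesis by (simp add: power2_eq_square mult_ac)
  qed
  from lpnorm_centered_le_influence[OF Y g(2) this]
  have "lpnorm S a ?Y \<le> sqrt (4 * a * a * 2 powr a * (real (card J) * \<Delta>\<^sup>2))"
    by (simp add: Y0)
  also have "\<dots> = sqrt (4 * a * a * 2 powr a) * \<Delta> * sqrt (real (card J))"
    using \<Delta>0 by (simp add: real_sqrt_mult)
  finally show "lpnorm S a ?Y \<le> sqrt (4 * a * a * 2 powr a) * \<Delta> * sqrt (real (card J))" .
qed

text \<open>L bounds both the size of a window and the number of windows over one lag. The influence
  on V is thus at most a multiple of L^(3/2) b k, with b summing to at most n \<Delta>, and the
  Efron-Stein bound with exponent q turns this into the factor n^(1/q).\<close>

theorem lpnorm_sum_squared_windows_le:
  fixes J :: "'i \<Rightarrow> nat set" and L :: real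
  assumes g: "g \<in> Lp S (2 * q)" "(\<integral>x. g x \<partial>S) = 0" and q: "1 < q" "q \<le> 2"
    and \<Delta>: "\<And>n. (\<Sum>k<n. influence (2 * q) k g) \<le> \<Delta>"
    and I: "finite I" and J: "\<And>i. i \<in> I \<Longrightarrow> J i \<subseteq> {..<n}"
    and L: "\<And>i. i \<in> I \<Longrightarrow> real (card (J i)) \<le> L"
    and mult: "\<And>j. j < n \<Longrightarrow> real (card {i \<in> I. j \<in> J i}) \<le> L" and L0: "0 \<le> L"
  defines "V \<equiv> \<lambda>x. \<Sum>i\<in>I. (\<Sum>j\<in>J i. lag j g x)\<^sup>2"
    and "K \<equiv> 2 * sqrt (4 * (2 * q) * (2 * q) * 2 powr (2 * q)) * \<Delta>\<^sup>2 * (2 * q) powr (1 / q)"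
  shows "lpnorm S q (\<lambda>x. V x - (\<integral>x. V x \<partial>S)) \<le> K * L powr (3 / 2) * real n powr (1 / q)"
proof -
  have q2: "2 < 2 * q" using q by simp
  define d where "d k = influence (2 * q) k g" for k
  define c where "c = sqrt (4 * (2 * q) * (2 * q) * 2 powr (2 * q))"
  have c0: "0 \<le> c" using q by (simp add: c_def)
  have \<Delta>0: "0 \<le> \<Delta>" using \<Delta>[of 0] by simp
  define b where "b k = (\<Sum>j<n. if j \<le> k then d (k - j) else 0)" for k
  define R where "R = 2 * c * \<Delta> * L powr (3 / 2)"
  have R0: "0 \<le> R" using c0 \<Delta>0 by (simp add: R_def)
  have b: "0 \<le> b k" "b k \<le> \<Delta>" "(\<Sum>k<N. b k) \<le> real n * \<Delta>" for k N
    using convolution_bounds[OF influence_nonneg \<Delta>, of "{..<n}"] unfolding b_def d_def by simp_all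
  have fin: "finite (J i)" if "i \<in> I" for i
    using J[OF that] finite_subset by blast
  define W where "W i x = (\<Sum>j\<in>J i. lag j g x)" for i x
  have W: "W i \<in> Lp S (2 * q)" "influence (2 * q) k (W i) \<le> (\<Sum>j\<in>J i. if j \<le> k then d (k - j) else 0)"
    "lpnorm S (2 * q) (W i) \<le> c * \<Delta> * sqrt L" if "i \<in> I" for i k
  proof -
    note * = lpnorm_lag_sum_le[OF g(1) q2 g(2) \<Delta> fin[OF that]]
    show "W i \<in> Lp S (2 * q)" using *(1) unfolding W_def[abs_def] .
    show "influence (2 * q) k (W i) \<le> (\<Sum>j\<in>J i. if j \<le> k then d (k - j) else 0)"
      using *(2) unfolding W_def[abs_def] d_def .
    have "lpnorm S (2 * q) (W i) \<le> c * \<Delta> * sqrt (real (card (J i)))"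
      using *(3) unfolding W_def[abs_def] c_def .
    also have "\<dots> \<le> c * \<Delta> * sqrt L"
      using c0 \<Delta>0 L[OF that] by (intro mult_left_mono) auto
    finally show "lpnorm S (2 * q) (W i) \<le> c * \<Delta> * sqrt L" .
  qed
  have W2: "(\<lambda>x. (W i x)\<^sup>2) \<in> Lp S q" if "i \<in> I" for i
    using lpnorm_mult_le(1)[OF W(1)[OF that] W(1)[OF that]] q by (simp add: power2_eq_square)
  have Veq: "V = (\<lambda>x. \<Sum>i\<in>I. (W i x)\<^sup>2)" by (simp add: V_def W_def)
  have V: "V \<in> Lp S q" unfolding Veq using W2 q by (intro Lp_sum) auto
  have infV: "influence q k V \<le> R * b k" for k
  proof -
    let ?e = "\<lambda>j. if j \<le> k then d (k - j) else 0"
    have e0: "0 \<le> ?e j" for j by (simp add: d_def)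
    have "influence q k V \<le> (\<Sum>i\<in>I. influence q k (\<lambda>x. (W i x)\<^sup>2))"
      unfolding Veq using W2 q by (intro influence_sum_le) auto
    also have "\<dots> \<le> (\<Sum>i\<in>I. 2 * (c * \<Delta> * sqrt L) * (\<Sum>j\<in>J i. ?e j))"
    proof (rule sum_mono)
      fix i assume i: "i \<in> I"
      have "influence q k (\<lambda>x. (W i x)\<^sup>2) \<le> 2 * lpnorm S (2 * q) (W i) * influence (2 * q) k (W i)"
        using W(1)[OF i] q by (intro influence_square_le) auto
      also have "\<dots> \<le> 2 * (c * \<Delta> * sqrt L) * (\<Sum>j\<in>J i. ?e j)"
        using W(2,3)[OF i] c0 \<Delta>0 L0 by (intro mult_mono) auto
      finally show "influence q k (\<lambda>x. (W i x)\<^sup>2) \<le> 2 * (c * \<Delta> * sqrt L) * (\<Sum>j\<in>J i. ?e j)" .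
    qed
    also have "\<dots> = 2 * (c * \<Delta> * sqrt L) * (\<Sum>i\<in>I. \<Sum>j\<in>J i. ?e j)"
      by (simp add: sum_distrib_left)
    also have "(\<Sum>i\<in>I. \<Sum>j\<in>J i. ?e j) = (\<Sum>i\<in>I. \<Sum>j<n. if j \<in> J i then ?e j else 0)"
    proof (rule sum.cong[OF refl])
      fix i assume "i \<in> I"
      then have "J i = {..<n} \<inter> J i" using J by auto
      then have "(\<Sum>j\<in>J i. ?e j) = (\<Sum>j\<in>{..<n} \<inter> J i. ?e j)" by simp
      also have "\<dots> = (\<Sum>j<n. if j \<in> J i then ?e j else 0)" by (rule sum.inter_restrict) simp
      finally show "(\<Sum>j\<in>J i. ?e j) = (\<Sum>j<n. if j \<in> J i then ?e j else 0)" .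
    qed
    \<comment> \<open>After the exchange each lag is counted once per window containing it, which
      \<open>mult\<close> bounds.\<close>
    also have "\<dots> = (\<Sum>j<n. \<Sum>i\<in>I. if j \<in> J i then ?e j else 0)" by (rule sum.swap)
    also have "\<dots> = (\<Sum>j<n. real (card {i \<in> I. j \<in> J i}) * ?e j)"
      using I by (intro sum.cong refl) (simp add: sum.inter_filter[symmetric])
    also have "2 * (c * \<Delta> * sqrt L) * \<dots> \<le> 2 * (c * \<Delta> * sqrt L) * (\<Sum>j<n. L * ?e j)"
      using mult e0 c0 \<Delta>0 L0 by (intro mult_left_mono sum_mono mult_right_mono) auto
    also have "\<dots> = 2 * c * \<Delta> * (sqrt L * L) * b k"
      by (simp add: b_def sum_distrib_left mult_ac)
    \<comment> \<open>The half power comes from the norm of a window sum, the full power from the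
      number of windows over a lag.\<close>
    also have "sqrt L * L = L powr (3 / 2)"
      using L0 powr_add[of L "1 / 2" 1] by (simp add: powr_half_sqrt)
    finally show ?thesis by (simp add: R_def)
  qed
  have "(\<Sum>k<N. influence q k V powr q) \<le> (R * \<Delta>) powr q * real n" for N
  proof -
    \<comment> \<open>All but one power of \<open>b k\<close> is bounded by \<Delta>; the remaining
      power is summed, which gives growth linear in n.\<close>
    have "(\<Sum>k<N. influence q k V powr q) \<le> (\<Sum>k<N. R powr q * (\<Delta> powr (q - 1) * b k))"
    proof (rule sum_mono)
      fix k
      have "influence q k V powr q \<le> (R * b k) powr q"
        using infV q by (intro powr_mono2) auto
      also have "\<dots> = R powr q * (b k powr (q - 1) * b k)"
        using b(1)[of k] powr_mult_base[of "b k" "q - 1"] by (simp add: powr_mult mult.commute)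
      also have "\<dots> \<le> R powr q * (\<Delta> powr (q - 1) * b k)"
        using b q by (intro mult_left_mono mult_right_mono powr_mono2) auto
      finally show "influence q k V powr q \<le> R powr q * (\<Delta> powr (q - 1) * b k)" .
    qed
    also have "\<dots> = R powr q * (\<Delta> powr (q - 1) * (\<Sum>k<N. b k))"
      by (simp add: sum_distrib_left)
    also have "\<dots> \<le> R powr q * (\<Delta> powr (q - 1) * (real n * \<Delta>))"
      using b by (intro mult_left_mono) auto
    also have "\<dots> = (R * \<Delta>) powr q * real n"
      using \<Delta>0 powr_mult_base[of \<Delta> "q - 1"] by (simp add: powr_mult mult_ac)
    finally show ?thesis .
  qed
  from integral_powr_centered_le_influence[OF V q this]
  have "(\<integral>x. \<bar>V x - (\<integral>x. V x \<partial>S)\<bar> powr q \<partial>S) \<le> 2 * q * ((R * \<Delta>) powr q * real n)" .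
  also have "\<dots> = ((2 * q) powr (1 / q) * (R * \<Delta>) * real n powr (1 / q)) powr q"
    using q by (simp add: powr_mult powr_powr)
  finally have "lpnorm S q (\<lambda>x. V x - (\<integral>x. V x \<partial>S)) \<le> (2 * q) powr (1 / q) * (R * \<Delta>) * real n powr (1 / q)"
    using q R0 \<Delta>0 by (intro lpnorm_le) auto
  also have "\<dots> = K * L powr (3 / 2) * real n powr (1 / q)"
    by (simp add: K_def R_def c_def power2_eq_square mult_ac)
  finally show ?thesis .
qed

end

section \<open>Block lengths\<close>

lemma tblock_bounds:
  assumes "1 \<le> i"
  shows "1 \<le> tblock a i" "tblock a i \<le> i"
    and "\<And>k. 1 \<le> k \<Longrightarrow> a k \<le> i \<Longrightarrow> a k \<le> tblock a i"
proof -
  let ?T = "{1} \<union> {a k |k. 1 \<le> k \<and> a k \<le> i}"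
  have "?T \<subseteq> {..i}" using assms by auto
  then have fin: "finite ?T" using finite_subset by blast
  show "1 \<le> tblock a i" unfolding tblock_def using fin by (intro Max_ge) auto
  show "tblock a i \<le> i" unfolding tblock_def using fin assms by (intro Max.boundedI) auto
  show "a k \<le> tblock a i" if "1 \<le> k" "a k \<le> i" for k
    unfolding tblock_def using fin that by (intro Max_ge) auto
qed

lemma powr_increment_le:
  fixes x p :: real
  assumes "0 \<le> x" "1 < p"
  shows "(x + 1) powr p - x powr p \<le> p * (x + 1) powr (p - 1)"
proof -
  obtain s where s: "0 < s" "s < 1"
    "\<bar>x + 1\<bar> powr p - \<bar>x\<bar> powr p = p * sgn_powr (p - 1) (x + s * 1) * 1"
    using abs_powr_mean_value assms(2) by blast
  have "sgn_powr (p - 1) (x + s) \<le> \<bar>sgn_powr (p - 1) (x + s)\<bar>" by (rule abs_ge_self)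
  also have "\<dots> \<le> (x + 1) powr (p - 1)"
    using s assms unfolding abs_sgn_powr by (intro powr_mono2) auto
  finally have "p * sgn_powr (p - 1) (x + s) \<le> p * (x + 1) powr (p - 1)"
    using assms by (intro mult_left_mono) auto
  then show ?thesis using s assms by simp
qed

text \<open>If i lies between \<open>a k\<close> and \<open>a (Suc k)\<close>, its block has length
  at most their difference, which is O(k^(p-1)); and \<open>a k\<close> \<le> n forces k =
  O(n^(1/p)).\<close>

lemma block_length_bound:
  fixes c p :: real
  assumes c: "0 < c" and p: "1 < p"
  defines "a \<equiv> \<lambda>k. nat \<lfloor>c * real k powr p\<rfloor>"
  obtains C where "0 \<le> C"
    "\<And>n i. 1 \<le> i \<Longrightarrow> i \<le> n \<Longrightarrow> real (i - tblock a i + 1) \<le> C * real n powr (1 - 1 / p)"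
proof
  \<comment> \<open>Chosen so that k + 1 \<le> A n^(1/p).\<close>
  define A where "A = (2 / c) powr (1 / p) + 1"
  \<comment> \<open>The summand 1 absorbs the rounding error of the floor, since 1 \<le> n^(1 -
    1/p).\<close>
  define C where "C = c * p * A powr (p - 1) + 1"
  have A0: "0 \<le> A" by (simp add: A_def add_nonneg_nonneg)
  show "0 \<le> C" using c p by (simp add: C_def)
  have a_le: "real (a k) \<le> c * real k powr p" and a_gt: "c * real k powr p < real (a k) + 1" for k
    using c unfolding a_def by (simp_all add: of_nat_nat)
  fix n i :: nat assume i: "1 \<le> i" "i \<le> n"
  have "\<exists>k. i < a (Suc k)"
  proof -
    obtain m :: nat where m: "(real i + 1) / c < real m" using reals_Archimedean2 by blast
    have "real i + 1 < c * real m" using m c by (simp add: field_simps)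
    also have "\<dots> \<le> c * real (Suc m)" using c by simp
    also have "real (Suc m) = real (Suc m) powr 1" by simp
    also have "c * \<dots> \<le> c * real (Suc m) powr p"
      using c p by (intro mult_left_mono powr_mono) auto
    also have "\<dots> < real (a (Suc m)) + 1" by (rule a_gt)
    finally have "i < a (Suc m)" by simp
    then show ?thesis ..
  qed
  \<comment> \<open>Before the first cut point k is 0, and \<open>a 0 = 0\<close> then serves as a
    lower bound for the block start 1. Minimality of k gives \<open>a k \<le> i\<close>
    otherwise.\<close>
  define k where "k = (LEAST k. i < a (Suc k))"
  have k1: "i < a (Suc k)" unfolding k_def using \<open>\<exists>k. i < a (Suc k)\<close> by (rule LeastI_ex)
  have k0: "a k \<le> i"
  proof (cases k)
    case 0
    then show ?thesis by (simp add: a_def)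
  next
    case (Suc m)
    then have "\<not> i < a (Suc m)" using not_less_Least[of m "\<lambda>k. i < a (Suc k)"] unfolding k_def by simp
    then show ?thesis using Suc by simp
  qed
  have "a k \<le> tblock a i"
  proof (cases k)
    case 0
    then show ?thesis by (simp add: a_def)
  qed (use tblock_bounds(3)[OF i(1), of k a] k0 in auto)
  then have "real (i - tblock a i + 1) \<le> real (a (Suc k)) - real (a k)"
    using k1 k0 tblock_bounds(2)[OF i(1), of a] by linarith
  also have "\<dots> \<le> c * real (Suc k) powr p - c * real k powr p + 1"
    using a_le[of "Suc k"] a_gt[of k] by simp
  also have "\<dots> = c * ((real k + 1) powr p - real k powr p) + 1"
    by (simp add: algebra_simps)
  also have "\<dots> \<le> c * (p * (real k + 1) powr (p - 1)) + 1"
    using c p powr_increment_le[of "real k" p] by (intro add_right_mono mult_left_mono) auto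
  also have "\<dots> \<le> c * (p * (A powr (p - 1) * real n powr (1 - 1 / p))) + 1"
  proof -
    have n1: "1 \<le> real n" using i by simp
    \<comment> \<open>c k^p < a k + 1 \<le> n + 1 \<le> 2n.\<close>
    have "c * real k powr p \<le> 2 * real n" using a_gt[of k] k0 i by simp
    then have "real k powr p \<le> 2 / c * real n" using c by (simp add: field_simps)
    then have "(real k powr p) powr (1 / p) \<le> (2 / c * real n) powr (1 / p)"
      using p by (intro powr_mono2) auto
    then have "real k \<le> (2 / c) powr (1 / p) * real n powr (1 / p)"
      using p unfolding powr_mult by (simp add: powr_powr)
    moreover have "1 \<le> real n powr (1 / p)" using n1 p by (intro ge_one_powr_ge_zero) auto
    ultimately have "real k + 1 \<le> A * real n powr (1 / p)" by (simp add: A_def algebra_simps)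
    then have "(real k + 1) powr (p - 1) \<le> (A * real n powr (1 / p)) powr (p - 1)"
      using p by (intro powr_mono2) auto
    also have "\<dots> = A powr (p - 1) * real n powr (1 - 1 / p)"
      using p by (simp add: powr_mult powr_powr diff_divide_distrib)
    finally show ?thesis using c p by (intro add_right_mono mult_left_mono) auto
  qed
  also have "\<dots> \<le> c * (p * (A powr (p - 1) * real n powr (1 - 1 / p))) + real n powr (1 - 1 / p)"
    using i p by (intro add_left_mono ge_one_powr_ge_zero) auto
  also have "\<dots> = C * real n powr (1 - 1 / p)" by (simp add: C_def algebra_simps)
  finally show "real (i - tblock a i + 1) \<le> C * real n powr (1 - 1 / p)" .
qed

text \<open>An interval from t i to i that contains m and has at most L points must end fewer than L
  steps after m, and the right endpoints i are distinct integers.\<close>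

lemma card_covering_le:
  fixes t :: "nat \<Rightarrow> nat" and L :: real
  assumes "\<And>i. i \<in> I \<Longrightarrow> t i \<le> m \<Longrightarrow> m \<le> i \<Longrightarrow> real (i - t i + 1) \<le> L" "0 \<le> L"
  shows "real (card {i \<in> I. t i \<le> m \<and> m \<le> i}) \<le> L"
proof -
  have "{i \<in> I. t i \<le> m \<and> m \<le> i} \<subseteq> {m..<m + nat \<lfloor>L\<rfloor>}"
  proof
    fix i assume "i \<in> {i \<in> I. t i \<le> m \<and> m \<le> i}"
    then have i: "i \<in> I" "t i \<le> m" "m \<le> i" by auto
    then have "i - t i + 1 \<le> nat \<lfloor>L\<rfloor>" using assms(1)[of i] by (intro le_nat_floor) auto
    then show "i \<in> {m..<m + nat \<lfloor>L\<rfloor>}" using i by auto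
  qed
  then have "card {i \<in> I. t i \<le> m \<and> m \<le> i} \<le> nat \<lfloor>L\<rfloor>"
    using card_mono[of "{m..<m + nat \<lfloor>L\<rfloor>}"] by fastforce
  then have "real (card {i \<in> I. t i \<le> m \<and> m \<le> i}) \<le> real (nat \<lfloor>L\<rfloor>)" by linarith
  also have "\<dots> \<le> L" using assms(2) by simp
  finally show ?thesis .
qed

lemma measurable_PiM_UNIV:
  assumes "\<And>k. f k \<in> measurable M N"
  shows "(\<lambda>\<omega> k. f k \<omega>) \<in> measurable M (\<Pi>\<^sub>M k\<in>UNIV. N)"
  using assms by (intro measurable_PiM_single') (auto intro: measurable_space[OF assms])

section \<open>Transfer to the sequence space\<close>

context prob_space
begin

text \<open>An injective enumeration reads each independent variable at most once, so the resulting
  sequence is again i.i.d. It is used both for the innovations listed backwards in time and for the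
  same list preceded by the independent copy.\<close>

lemma distr_iid_reindex:
  fixes Z :: "'i \<Rightarrow> 'a \<Rightarrow> 'e" and f :: "nat \<Rightarrow> 'i"
  assumes rv: "\<And>i. Z i \<in> measurable M E" and indep: "indep_vars (\<lambda>_. E) Z UNIV"
    and law: "\<And>i. distr M E (Z i) = N" and f: "inj f"
  shows "distr M (\<Pi>\<^sub>M k\<in>UNIV. N) (\<lambda>\<omega> k. Z (f k) \<omega>) = (\<Pi>\<^sub>M k\<in>UNIV. N)"
proof -
  have sN: "sets N = sets E" using law[of undefined] by (metis sets_distr)
  have N: "prob_space N" using law[of undefined] rv prob_space_distr by metis
  have sP: "sets (\<Pi>\<^sub>M i\<in>UNIV. E) = sets (\<Pi>\<^sub>M i\<in>(UNIV :: 'i set). N)"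
    using sN by (intro sets_PiM_cong) auto
  have Z: "(\<lambda>\<omega> i. Z i \<omega>) \<in> measurable M (\<Pi>\<^sub>M i\<in>UNIV. N)"
    using rv measurable_cong_sets[OF refl sN] by (intro measurable_PiM_UNIV) blast
  have "distr M (\<Pi>\<^sub>M i\<in>UNIV. N) (\<lambda>\<omega> i. Z i \<omega>) = distr M (\<Pi>\<^sub>M i\<in>UNIV. E) (\<lambda>\<omega>. \<lambda>i\<in>UNIV. Z i \<omega>)"
    using sP by (intro distr_cong) auto
  also have "\<dots> = (\<Pi>\<^sub>M i\<in>UNIV. distr M E (Z i))"
    using indep rv indep_vars_iff_distr_eq_PiM[of UNIV Z "\<lambda>_. E"] by simp
  finally have all: "distr M (\<Pi>\<^sub>M i\<in>UNIV. N) (\<lambda>\<omega> i. Z i \<omega>) = (\<Pi>\<^sub>M i\<in>UNIV. N)"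
    by (simp add: law)
  have r: "(\<lambda>\<omega> k. \<omega> (f k)) \<in> measurable (\<Pi>\<^sub>M i\<in>UNIV. N) (\<Pi>\<^sub>M k\<in>UNIV. N)"
    by (rule measurable_PiM_single') (auto simp: space_PiM)
  have "distr M (\<Pi>\<^sub>M k\<in>UNIV. N) (\<lambda>\<omega> k. Z (f k) \<omega>)
      = distr (distr M (\<Pi>\<^sub>M i\<in>UNIV. N) (\<lambda>\<omega> i. Z i \<omega>)) (\<Pi>\<^sub>M k\<in>UNIV. N) (\<lambda>\<omega> k. \<omega> (f k))"
    using Z r by (simp add: distr_distr comp_def)
  also have "\<dots> = (\<Pi>\<^sub>M k\<in>UNIV. N)"
    using distr_PiM_reindex[of UNIV "\<lambda>_. N" f UNIV] N f by (simp add: all restrict_def)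
  finally show ?thesis .
qed

end

text \<open>Inverts the prepending map of \<open>PiM_iter\<close>; it serves to separate \<epsilon>'
  from the innovations.\<close>

lemma (in sequence_space) distr_uncons:
  "distr S (M \<Otimes>\<^sub>M S) (\<lambda>x. (x 0, \<lambda>k. x (Suc k))) = M \<Otimes>\<^sub>M S"
proof -
  have [measurable]: "(\<lambda>x k. x (Suc k)) \<in> measurable S S"
    using measurable_shift[of 1] by simp
  have "distr S (M \<Otimes>\<^sub>M S) (\<lambda>x. (x 0, \<lambda>k. x (Suc k)))
      = distr (distr (M \<Otimes>\<^sub>M S) S (\<lambda>(s, \<omega>). case_nat s \<omega>)) (M \<Otimes>\<^sub>M S) (\<lambda>x. (x 0, \<lambda>k. x (Suc k)))"
    by (simp add: PiM_iter)
  also have "\<dots> = distr (M \<Otimes>\<^sub>M S) (M \<Otimes>\<^sub>M S) (\<lambda>z. z)"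
    by (subst distr_distr) (auto simp: comp_def split_beta')
  finally show ?thesis by simp
qed

theorem theorem2:
  fixes M :: "'a measure" and E :: "'e measure"
    and \<epsilon> :: "int \<Rightarrow> 'a \<Rightarrow> 'e" and \<epsilon>' :: "'a \<Rightarrow> 'e"
    and g :: "(nat \<Rightarrow> 'e) \<Rightarrow> real"
    and c p \<alpha> :: real
  assumes "prob_space M"
    and rv: "\<And>i. \<epsilon> i \<in> measurable M E" and rv': "\<epsilon>' \<in> measurable M E"
    and indep: "prob_space.indep_vars M (\<lambda>_. E)
                  (\<lambda>k. case k of None \<Rightarrow> \<epsilon>' | Some i \<Rightarrow> \<epsilon> i) (UNIV :: int option set)"
    and ident: "\<And>i. distr M E (\<epsilon> i) = distr M E (\<epsilon> 0)"
    and ident': "distr M E \<epsilon>' = distr M E (\<epsilon> 0)"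
    and g_meas: "g \<in> borel_measurable (PiM UNIV (\<lambda>_. E))"
    and c_pos: "c > 0" and p_gt: "p > 1"
    and alpha: "2 < \<alpha>" "\<alpha> \<le> 4"
    and mean0: "\<And>i. (\<integral>\<omega>. Xshift \<epsilon> g i \<omega> \<partial>M) = 0"
    and Lalpha: "\<And>i. integrable M (\<lambda>\<omega>. \<bar>Xshift \<epsilon> g i \<omega>\<bar> powr \<alpha>)"
    and dep: "summable (\<lambda>j. phys_dep M \<epsilon> \<epsilon>' g \<alpha> j)"
  shows "(\<lambda>n. lpnorm M (\<alpha> / 2)
            (\<lambda>\<omega>. Vsum (\<lambda>k. nat \<lfloor>c * real k powr p\<rfloor>) (Xshift \<epsilon> g) n \<omega>
                  - (\<integral>\<omega>'. Vsum (\<lambda>k. nat \<lfloor>c * real k powr p\<rfloor>) (Xshift \<epsilon> g) n \<omega>' \<partial>M)))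
         \<in> O(\<lambda>n. real n powr (3/2 - 3 / (2 * p) + 2 / \<alpha>))"
proof -
  interpret M: prob_space M by fact
  define N where "N = distr M E (\<epsilon> 0)"
  have probN: "prob_space N" unfolding N_def using rv by (rule M.prob_space_distr)
  interpret N: sequence_space N
  proof -
    interpret N: prob_space N by fact
    show "sequence_space N" by unfold_locales
  qed
  have sN: "sets N = sets E" by (simp add: N_def)
  have gS [measurable]: "g \<in> borel_measurable N.S"
    using g_meas measurable_cong_sets[OF sets_PiM_cong[OF refl sN] refl, of UNIV borel] by blast
  define Z where "Z k = (case k of None \<Rightarrow> \<epsilon>' | Some i \<Rightarrow> \<epsilon> i)" for k
  have Z: "Z k \<in> measurable M E" "distr M E (Z k) = N" for k
    using rv rv' ident ident' by (auto simp: Z_def N_def split: option.split)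
  have Zind: "M.indep_vars (\<lambda>_. E) Z UNIV" using indep by (simp add: Z_def[abs_def])
  note law = M.distr_iid_reindex[OF Z(1) Zind Z(2)]
  \<comment> \<open>For fixed n all of X_1, ..., X_n become functions of this one sequence.\<close>
  define past where "past n \<omega> k = \<epsilon> (int n - int k) \<omega>" for n :: nat and \<omega> and k :: nat
  have \<epsilon>N: "\<epsilon> i \<in> measurable M N" "\<epsilon>' \<in> measurable M N" for i
    using rv rv' measurable_cong_sets[OF refl sN] by blast+
  have past [measurable]: "past n \<in> measurable M N.S" for n
    unfolding past_def[abs_def] using \<epsilon>N
    by (intro measurable_PiM_UNIV)
  have dpast: "distr M N.S (past n) = N.S" for n
    using law[of "\<lambda>k. Some (int n - int k)"] by (simp add: inj_def past_def[abs_def] Z_def)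
  have dpair: "distr M (N \<Otimes>\<^sub>M N.S) (\<lambda>\<omega>. (\<epsilon>' \<omega>, past n \<omega>)) = N \<Otimes>\<^sub>M N.S" for n
  proof -
    \<comment> \<open>This enumeration lists \<epsilon>' first and then the innovations backwards
      from time n; splitting off the head gives the pair.\<close>
    let ?f = "case_nat None (\<lambda>k. Some (int n - int k))"
    have f: "inj ?f" by (auto simp: inj_def split: nat.splits)
    have m: "(\<lambda>\<omega> k. Z (?f k) \<omega>) \<in> measurable M N.S"
      using Z(1) measurable_cong_sets[OF refl sN]
      by (intro measurable_PiM_UNIV) blast
    have [measurable]: "(\<lambda>x k. x (Suc k)) \<in> measurable N.S N.S"
      using N.measurable_shift[of 1] by simp
    have "N \<Otimes>\<^sub>M N.S = distr (distr M N.S (\<lambda>\<omega> k. Z (?f k) \<omega>)) (N \<Otimes>\<^sub>M N.S) (\<lambda>x. (x 0, \<lambda>k. x (Suc k)))"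
      using law[OF f] N.distr_uncons by simp
    also have "\<dots> = distr M (N \<Otimes>\<^sub>M N.S) (\<lambda>\<omega>. (\<epsilon>' \<omega>, past n \<omega>))"
      using m by (subst distr_distr) (auto simp: comp_def Z_def past_def[abs_def])
    finally show ?thesis ..
  qed
  have X: "Xshift \<epsilon> g (int n - int j) \<omega> = N.lag j g (past n \<omega>)" for n j \<omega>
    by (simp add: Xshift_def N.lag_def past_def algebra_simps)
  have X0: "Xshift \<epsilon> g (int n) \<omega> = g (past n \<omega>)" for n \<omega>
    by (simp add: Xshift_def past_def[abs_def])
  have gL: "g \<in> Lp N.S \<alpha>"
    using Lp_distr_iff[of "past 0" M N.S g \<alpha>] Lalpha[of "int 0"]
    unfolding dpast X0 by (simp add: Lp_def)
  have g0: "(\<integral>x. g x \<partial>N.S) = 0"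
    using integral_distr[of "past 0" M N.S g] mean0[of "int 0"] unfolding dpast X0 by simp
  \<comment> \<open>Coordinate j of \<open>past j\<close> is the innovation at time 0, so the
    coupling overwrites exactly this coordinate.\<close>
  have dep_eq: "phys_dep M \<epsilon> \<epsilon>' g \<alpha> j = N.influence \<alpha> j g" for j
  proof -
    let ?G = "\<lambda>(e, x). g x - g (x(j := e))"
    have G: "?G \<in> borel_measurable (N \<Otimes>\<^sub>M N.S)" by measurable
    have T: "(\<lambda>\<omega>. (\<epsilon>' \<omega>, past j \<omega>)) \<in> measurable M (N \<Otimes>\<^sub>M N.S)"
      using \<epsilon>N past by measurable
    have "Xcoupled \<epsilon> \<epsilon>' g (int j) \<omega> = g ((past j \<omega>)(j := \<epsilon>' \<omega>))" for \<omega>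
      unfolding Xcoupled_def by (intro arg_cong[where f = g]) (auto simp: past_def fun_eq_iff)
    then have "phys_dep M \<epsilon> \<epsilon>' g \<alpha> j = lpnorm M \<alpha> (\<lambda>\<omega>. ?G (\<epsilon>' \<omega>, past j \<omega>))"
      by (simp add: phys_dep_def X0)
    also have "\<dots> = N.influence \<alpha> j g"
      using lpnorm_distr[OF T G, of \<alpha>] unfolding dpair N.influence_def by simp
    finally show ?thesis .
  qed
  define \<Delta> where "\<Delta> = (\<Sum>j. N.influence \<alpha> j g)"
  have \<Delta>: "(\<Sum>k<n. N.influence \<alpha> k g) \<le> \<Delta>" for n
    unfolding \<Delta>_def using dep by (intro sum_le_suminf) (auto simp: dep_eq)
  define a where "a = (\<lambda>k. nat \<lfloor>c * real k powr p\<rfloor>)"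
  obtain C where C: "0 \<le> C"
    "\<And>n i. 1 \<le> i \<Longrightarrow> i \<le> n \<Longrightarrow> real (i - tblock a i + 1) \<le> C * real n powr (1 - 1 / p)"
    using block_length_bound[OF c_pos p_gt] unfolding a_def by metis
  \<comment> \<open>The constant of \<open>lpnorm_sum_squared_windows_le\<close> at q = \<alpha>/2,
    where 2q = \<alpha> and 1/q = 2/\<alpha>.\<close>
  define K where "K = 2 * sqrt (4 * \<alpha> * \<alpha> * 2 powr \<alpha>) * \<Delta>\<^sup>2 * \<alpha> powr (2 / \<alpha>)"
  have "lpnorm M (\<alpha> / 2) (\<lambda>\<omega>. Vsum a (Xshift \<epsilon> g) n \<omega> - (\<integral>\<omega>'. Vsum a (Xshift \<epsilon> g) n \<omega>' \<partial>M))
      \<le> K * C powr (3 / 2) * real n powr (3/2 - 3 / (2 * p) + 2 / \<alpha>)" for n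
  proof -
    define L where "L = C * real n powr (1 - 1 / p)"
    have L0: "0 \<le> L" using C by (simp add: L_def)
    \<comment> \<open>The times of block i, from \<open>tblock a i\<close> to i, expressed as lags
      behind n.\<close>
    define J where "J i = {n - i..n - tblock a i}" for i
    define V where "V x = (\<Sum>i\<in>{1..n}. (\<Sum>j\<in>J i. N.lag j g x)\<^sup>2)" for x
    have J: "J i \<subseteq> {..<n}" "real (card (J i)) \<le> L" if "i \<in> {1..n}" for i
    proof -
      have i: "1 \<le> i" "i \<le> n" using that by auto
      note t = tblock_bounds(1,2)[OF i(1), of a]
      show "J i \<subseteq> {..<n}" using t i by (auto simp: J_def)
      have "card (J i) = i - tblock a i + 1" using t i by (simp add: J_def)
      then show "real (card (J i)) \<le> L" using C(2)[OF i] by (simp add: L_def)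
    qed
    have mult: "real (card {i \<in> {1..n}. j \<in> J i}) \<le> L" if "j < n" for j
    proof -
      \<comment> \<open>Lag j belongs to window i iff time n - j lies in block i; here j < n makes n
        - j a genuine time \<ge> 1.\<close>
      have eq: "{i \<in> {1..n}. j \<in> J i} = {i \<in> {1..n}. tblock a i \<le> n - j \<and> n - j \<le> i}"
        using that tblock_bounds(2)[of _ a] by (fastforce simp: J_def)
      show ?thesis
        unfolding eq
      proof (rule card_covering_le)
        show "real (i - tblock a i + 1) \<le> L" if "i \<in> {1..n}" for i
          unfolding L_def using that by (intro C(2)) auto
      qed (rule L0)
    qed
    have VX: "Vsum a (Xshift \<epsilon> g) n \<omega> = V (past n \<omega>)" for \<omega>
      unfolding Vsum_def V_def
    proof (intro sum.cong refl arg_cong[where f = "\<lambda>x. x\<^sup>2"])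
      fix i assume "i \<in> {1..n}"
      then have i: "1 \<le> i" "i \<le> n" by auto
      note t = tblock_bounds(1,2)[OF i(1), of a]
      show "Wblock a (Xshift \<epsilon> g) i \<omega> = (\<Sum>j\<in>J i. N.lag j g (past n \<omega>))"
        unfolding Wblock_def
        by (rule sum.reindex_bij_witness[of _ "\<lambda>j. n - j" "\<lambda>j. n - j"])
          (use i t in \<open>auto simp: J_def X[symmetric] of_nat_diff\<close>)
    qed
    have [measurable]: "V \<in> borel_measurable N.S" unfolding V_def[abs_def] by measurable
    have "(\<integral>\<omega>. V (past n \<omega>) \<partial>M) = (\<integral>x. V x \<partial>N.S)"
      using integral_distr[of "past n" M N.S V] unfolding dpast by simp
    then have "lpnorm M (\<alpha> / 2) (\<lambda>\<omega>. Vsum a (Xshift \<epsilon> g) n \<omega> - (\<integral>\<omega>'. Vsum a (Xshift \<epsilon> g) n \<omega>' \<partial>M))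
        = lpnorm N.S (\<alpha> / 2) (\<lambda>x. V x - (\<integral>x. V x \<partial>N.S))"
      using lpnorm_distr[of "past n" M N.S "\<lambda>x. V x - (\<integral>x. V x \<partial>N.S)" "\<alpha> / 2"]
      unfolding dpast by (simp add: VX)
    also have "\<dots> \<le> K * L powr (3 / 2) * real n powr (2 / \<alpha>)"
      using N.lpnorm_sum_squared_windows_le[of g "\<alpha> / 2" \<Delta> "{1..n}" J n L] gL g0 alpha \<Delta> J mult L0
      by (simp add: V_def[abs_def] K_def)
    also have "\<dots> = K * C powr (3 / 2) * real n powr (3/2 - 3 / (2 * p) + 2 / \<alpha>)"
    proof -
      \<comment> \<open>The block length to the power 3/2 supplies the first two terms of the
        exponent; 2/\<alpha> comes from the number of innovations.\<close>
      have exponent: "(1 - 1 / p) * (3 / 2) = 3/2 - 3 / (2 * p)"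
        using p_gt by (simp add: field_simps)
      have "L powr (3 / 2) = C powr (3 / 2) * real n powr (3/2 - 3 / (2 * p))"
        unfolding L_def powr_mult powr_powr exponent ..
      then show ?thesis by (simp add: powr_add)
    qed
    finally show ?thesis .
  qed
  then show ?thesis
    unfolding a_def[symmetric] by (intro bigoI[of _ "K * C powr (3 / 2)"]) simp
qed

end
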